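(* Let $K$ be a field of characteristic $0$, let $\ell\ge2$, and let $n_1\le n_2\le\dots\le n_\ell$ be positive integers. For every $0\le k\le\ell$, the divisor in $\mathbb{P}^\ell$ defined by the homogeneous polynomial $$x_0\cdot F_k^h=x_0\,p\cdot\prod_{1\le i<j\le\ell}(x_i^{n_i}x_0^{n_j-n_i}-x_j^{n_j})\in K[x_0,\dots,x_\ell],\qquad p=\begin{cases}1,&k=0\\ x_1\cdots x_k,&1\le k\le\ell,\end{cases}$$ is free with exponents $$(1,\ n_\ell+1,\ n_\ell+n_{\ell-1}+1,\ \dots,\ n_\ell+n_{\ell-1}+\dots+n_3+1,\ n_\ell+n_{\ell-1}+\dots+n_2+1-\ell+k).$$
   Context: Here $F_k=p\prod_{1\le i<j\le\ell}(x_i^{n_i}-x_j^{n_j})$ and $F_k^h$ is its homogenization with respect to $x_0$. The exponent list has $\ell$ entries: $1$; the numbers $n_\ell+n_{\ell-1}+\dots+n_{s}+1$ for $s=\ell,\ell-1,\dots,3$; and the last entry $n_\ell+\dots+n_2+1-\ell+k$ (so for $\ell=2$ the list is $(1,\,n_2-1+k)$). For a reduced homogeneous polynomial $f\in S=K[x_0,\dots,x_\ell]$ (standard grading), $\mathrm{Der}_0(f)=\{\delta\in\mathrm{Der}_K(S):\delta(f)=0\}$, where a derivation $\sum g_i\partial_{x_i}$ is homogeneous of degree $a$ if all $g_i$ are homogeneous of degree $a$ (or zero). The divisor $V(f)\subset\mathbb{P}^\ell$ is free with exponents $(a_1,\dots,a_\ell)$ if $\mathrm{Der}_0(f)$ is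 a free $S$-module with a basis of $\ell$ homogeneous derivations of degrees $a_1,\dots,a_\ell$ (in any order). Equivalently, $\{\delta:\delta(f)\in Sf\}$ is free with basis the Euler derivation and homogeneous derivations of degrees $a_1,\dots,a_\ell$. *)

theory Defs
  imports
    "HOL-Library.Poly_Mapping"
    "HOL-Library.FuncSet"
    "HOL-Computational_Algebra.Squarefree"
begin

text \<open>Polynomials over \<open>'a\<close> in the countably many variables \<open>x\<^sub>0, x\<^sub>1, x\<^sub>2, \<dots>\<close>, as finitely
  supported functions from exponent vectors to coefficients. The ring \<open>K[x\<^sub>0, \<dots>, x\<^sub>l]\<close> is the
  subring \<open>polys l\<close> below, so that \<open>l\<close> can be a variable of type \<^typ>\<open>nat\<close>.\<close>

type_synonym 'a mpoly = "(nat \<Rightarrow>\<^sub>0 nat) \<Rightarrow>\<^sub>0 'a"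

definition pvar :: "nat \<Rightarrow> 'a::comm_ring_1 mpoly" where
  "pvar i = Poly_Mapping.single (Poly_Mapping.single i 1) 1"

definition pconst :: "'a::comm_ring_1 \<Rightarrow> 'a mpoly" where
  "pconst c = Poly_Mapping.single 0 c"

definition polys :: "nat \<Rightarrow> 'a::comm_ring_1 mpoly set" where
  "polys l = {g. \<forall>m\<in>Poly_Mapping.keys g. Poly_Mapping.keys m \<subseteq> {0..l}}"

text \<open>The zero polynomial is homogeneous of every degree.\<close>

definition homogeneous :: "nat \<Rightarrow> 'a::comm_ring_1 mpoly \<Rightarrow> bool" where
  "homogeneous d g \<longleftrightarrow> (\<forall>m\<in>Poly_Mapping.keys g. (\<Sum>i\<in>Poly_Mapping.keys m. Poly_Mapping.lookup m i) = d)"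

text \<open>\<open>K\<close>-linear derivations of \<open>polys l\<close>. Only the values on \<open>polys l\<close> matter; below, derivations
  are compared on this set only.\<close>

definition derivations :: "nat \<Rightarrow> ('a::comm_ring_1 mpoly \<Rightarrow> 'a mpoly) set" where
  "derivations l = {\<delta> \<in> polys l \<rightarrow> polys l.
     (\<forall>g\<in>polys l. \<forall>h\<in>polys l. \<delta> (g + h) = \<delta> g + \<delta> h) \<and>
     (\<forall>c. \<forall>g\<in>polys l. \<delta> (pconst c * g) = pconst c * \<delta> g) \<and>
     (\<forall>g\<in>polys l. \<forall>h\<in>polys l. \<delta> (g * h) = g * \<delta> h + h * \<delta> g)}"

text \<open>A derivation \<open>\<delta>\<close> equals \<open>\<Sum>j\<le>l. \<delta>(x\<^sub>j) \<partial>/\<partial>x\<^sub>j\<close>; its coefficients are the \<open>\<delta>(x\<^sub>j)\<close>.\<close>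

definition homogeneous_derivation ::
    "nat \<Rightarrow> nat \<Rightarrow> ('a::comm_ring_1 mpoly \<Rightarrow> 'a mpoly) \<Rightarrow> bool" where
  "homogeneous_derivation l d \<delta> \<longleftrightarrow> (\<forall>j\<le>l. homogeneous d (\<delta> (pvar j)))"

definition Der0 :: "nat \<Rightarrow> 'a::comm_ring_1 mpoly \<Rightarrow> ('a mpoly \<Rightarrow> 'a mpoly) set" where
  "Der0 l f = {\<delta> \<in> derivations l. \<delta> f = 0}"

text \<open>\<open>\<theta> 0, \<dots>, \<theta> (r - 1)\<close> is a basis of the \<open>polys l\<close>-module \<open>M\<close> of derivations.\<close>

definition derivation_basis ::
    "nat \<Rightarrow> ('a::comm_ring_1 mpoly \<Rightarrow> 'a mpoly) set \<Rightarrow> nat \<Rightarrow> (nat \<Rightarrow> 'a mpoly \<Rightarrow> 'a mpoly) \<Rightarrow> bool" where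
  "derivation_basis l M r \<theta> \<longleftrightarrow>
     (\<forall>i<r. \<theta> i \<in> M) \<and>
     (\<forall>\<delta>\<in>M. \<exists>!c. c \<in> {..<r} \<rightarrow>\<^sub>E polys l \<and> (\<forall>g\<in>polys l. \<delta> g = (\<Sum>i<r. c i * \<theta> i g)))"

text \<open>The divisor \<open>V(f)\<close> in projective \<open>l\<close>-space is free with exponents \<open>as\<close>. Divisors in the
  ambient type of a nonzero element of \<open>polys l\<close> lie in \<open>polys l\<close>, so \<^const>\<open>squarefree\<close>
  means that \<open>f\<close> is reduced in \<open>polys l\<close>.\<close>

definition free_divisor :: "nat \<Rightarrow> 'a::comm_ring_1 mpoly \<Rightarrow> nat list \<Rightarrow> bool" where
  "free_divisor l f as \<longleftrightarrow>
     f \<in> polys l \<and> (\<exists>d. homogeneous d f) \<and> squarefree f \<and> length as = l \<and>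
     (\<exists>\<theta>. derivation_basis l (Der0 l f) l \<theta> \<and>
          (\<forall>i<l. homogeneous_derivation l (as ! i) (\<theta> i)))"

text \<open>The polynomial \<open>x\<^sub>0 F\<^sub>k\<^sup>h\<close>; for \<open>k = 0\<close> the product \<open>p = x\<^sub>1 \<cdots> x\<^sub>k\<close> is empty. The subtraction
  \<open>n j - n i\<close> is exact because \<open>n\<close> is increasing.\<close>

definition x0_Fh :: "nat \<Rightarrow> (nat \<Rightarrow> nat) \<Rightarrow> nat \<Rightarrow> 'a::comm_ring_1 mpoly" where
  "x0_Fh l n k =
     pvar 0 * (\<Prod>i\<in>{1..k}. pvar i) *
     (\<Prod>(i, j)\<in>{(i, j). 1 \<le> i \<and> i < j \<and> j \<le> l}.
        pvar i ^ n i * pvar 0 ^ (n j - n i) - pvar j ^ n j)"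

text \<open>The middle entries are indexed by \<open>s = l, l - 1, \<dots>, 3\<close>. The subtraction in the last entry is
  exact because \<open>n\<close> is positive.\<close>

definition exponent_list :: "nat \<Rightarrow> (nat \<Rightarrow> nat) \<Rightarrow> nat \<Rightarrow> nat list" where
  "exponent_list l n k =
     [1] @ map (\<lambda>s. (\<Sum>i\<in>{s..l}. n i) + 1) (rev [3..<Suc l]) @
     [(\<Sum>i\<in>{2..l}. n i) + 1 + k - l]"

end

theory Submission
  imports Defs
begin

text \<open>Subtracting a multiple of the Euler field, it suffices to find a basis of the vector fields
  without \<open>\<partial>/\<partial>x\<^sub>0\<close> that are logarithmic along the divisor. For \<open>k = l\<close> a field
  whose coefficients vanish beyond the index \<open>s\<close> has \<open>s\<close>-th coefficient divisible by
  \<open>x\<^sub>s (\<Prod>\<^bsub>t>s\<^esub> P\<^bsub>st\<^esub>)\<close>, where \<open>P\<^bsub>st\<^esub>\<close> is the factor \<open>x\<^sub>s ^ n\<^sub>s x\<^sub>0 ^ (n\<^sub>t - n\<^sub>s) - x\<^sub>t ^ n\<^sub>t\<close>;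
  triangular elimination then gives a basis \<open>\<theta>\<^sub>l, \<dots>, \<theta>\<^sub>1\<close>. By Newton interpolation, \<open>\<theta>\<^sub>1\<close> may be
  replaced by a field \<open>\<lambda>\<close> all of whose coefficients are monomials. When a factor \<open>x\<^sub>j\<close> is
  dropped from \<open>p\<close>, dividing \<open>\<lambda>\<close> by \<open>x\<^sub>j\<close> yields a basis again.

  Only a weak form of unique factorization is needed: the factors of the polynomial are pairwise
  non-zero-divisors modulo each other, which is seen by comparing degrees in one variable.\<close>

abbreviation "lookup \<equiv> Poly_Mapping.lookup"
abbreviation "keys \<equiv> Poly_Mapping.keys"
abbreviation "single \<equiv> Poly_Mapping.single"

subsection \<open>Relative primality in a domain without gcds\<close>

text \<open>The conclusion of Euclid's lemma is taken as a definition: \<open>b\<close> is a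
  non-zero-divisor modulo \<open>a\<close>. As it stands, the relation is not symmetric.\<close>

definition relprime :: "'a::comm_semiring_1 \<Rightarrow> 'a \<Rightarrow> bool" where
  "relprime a b \<longleftrightarrow> (\<forall>h. a dvd b * h \<longrightarrow> a dvd h)"

lemma relprimeI: "(\<And>h. a dvd b * h \<Longrightarrow> a dvd h) \<Longrightarrow> relprime a b"
  unfolding relprime_def by blast

lemma relprimeD: "relprime a b \<Longrightarrow> a dvd b * h \<Longrightarrow> a dvd h"
  unfolding relprime_def by blast

lemma relprime_1_right [simp]: "relprime a 1"
  by (simp add: relprime_def)

lemma relprime_mult_right: "relprime a b \<Longrightarrow> relprime a c \<Longrightarrow> relprime a (b * c)"
  unfolding relprime_def mult.assoc by blast

lemma relprime_power_right: "relprime a b \<Longrightarrow> relprime a (b ^ e)"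
  by (induction e) (auto intro: relprime_mult_right)

lemma relprime_prod_right: "(\<And>i. i \<in> A \<Longrightarrow> relprime a (f i)) \<Longrightarrow> relprime a (prod f A)"
  by (induction A rule: infinite_finite_induct) (auto intro: relprime_mult_right)

text \<open>If \<open>a * h = b * u\<close>, then \<open>a\<close> divides \<open>u\<close>, and
  cancelling \<open>a\<close> shows that \<open>b\<close> divides \<open>h\<close>.\<close>

lemma relprime_sym:
  fixes a b :: "'a::idom"
  assumes "relprime a b" "a \<noteq> 0"
  shows "relprime b a"
proof (rule relprimeI)
  fix h assume "b dvd a * h"
  then obtain u where u: "a * h = b * u" by (auto simp: dvd_def)
  then have "a dvd u" using relprimeD[OF assms(1)] by (metis dvd_triv_left)
  then obtain v where "u = a * v" by (auto simp: dvd_def)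
  with u have "a * h = a * (b * v)" by (simp add: algebra_simps)
  with assms(2) show "b dvd h" by simp
qed

lemma relprime_power:
  fixes a b :: "'a::idom"
  assumes "relprime a b" "a \<noteq> 0" "b \<noteq> 0"
  shows "relprime (a ^ d) (b ^ e)"
  by (meson assms relprime_power_right relprime_sym)

lemma relprime_dvd_right: "relprime a b \<Longrightarrow> x dvd b \<Longrightarrow> relprime a x"
  unfolding relprime_def by (meson dvd_trans dvd_refl mult_dvd_mono)

text \<open>Only the residue of \<open>b\<close> modulo \<open>a\<close> matters, so a complicated
  \<open>b\<close> may be traded for a simpler one.\<close>

lemma relprime_cong:
  fixes a b c :: "'a::comm_ring_1"
  assumes "relprime a c" "a dvd b - c"
  shows "relprime a b"
proof (rule relprimeI)
  fix h assume "a dvd b * h"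
  moreover have "a dvd (b - c) * h" using assms(2) by simp
  ultimately have "a dvd b * h - (b - c) * h" by (rule dvd_diff)
  then show "a dvd h" using assms(1) by (auto simp: algebra_simps dest: relprimeD)
qed

lemma relprime_mult_dvd:
  assumes "relprime a b" "a dvd h" "b dvd h"
  shows "a * b dvd h"
proof -
  obtain v where v: "h = b * v" using assms(3) by (rule dvdE)
  then have "a dvd v" using assms by (metis relprimeD)
  then show ?thesis by (simp add: v mult.commute[of a] mult_dvd_mono)
qed

lemma prod_dvd_relprime:
  assumes "finite A" "\<And>i j. i \<in> A \<Longrightarrow> j \<in> A \<Longrightarrow> i \<noteq> j \<Longrightarrow> relprime (f i) (f j)"
    and "\<And>i. i \<in> A \<Longrightarrow> f i dvd h"
  shows "prod f A dvd h"
  using assms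
proof (induction A rule: finite_induct)
  case (insert i A)
  have "relprime (f i) (prod f A)"
    using insert by (intro relprime_prod_right) auto
  then show ?case using insert by (simp add: relprime_mult_dvd)
qed auto

lemma relprime_mult_left:
  fixes a b c :: "'a::idom"
  assumes "relprime a c" "relprime b c" "a \<noteq> 0"
  shows "relprime (a * b) c"
proof (rule relprimeI)
  fix h assume "a * b dvd c * h"
  then obtain u where u: "c * h = a * b * u" by (rule dvdE)
  then have "a dvd c * h" by (simp add: mult.assoc)
  then have "a dvd h" by (rule relprimeD[OF assms(1)])
  then obtain v where v: "h = a * v" by (rule dvdE)
  have "a * (c * v) = a * (b * u)" using u v by (simp add: algebra_simps)
  then have "b dvd c * v" using assms(3) by simp
  then have "b dvd v" by (rule relprimeD[OF assms(2)])
  then show "a * b dvd h" by (simp add: v mult_dvd_mono)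
qed

lemma relprime_1_left [simp]: "relprime 1 a"
  by (simp add: relprime_def)

lemma relprime_prod_left:
  fixes f :: "'b \<Rightarrow> 'a::idom"
  assumes "\<And>i. i \<in> A \<Longrightarrow> relprime (f i) c" "\<And>i. i \<in> A \<Longrightarrow> f i \<noteq> 0"
  shows "relprime (prod f A) c"
proof (cases "finite A")
  case True
  then show ?thesis using assms
    by (induction A rule: finite_induct) (auto intro: relprime_mult_left)
qed simp

lemma relprime_unit: "u dvd 1 \<Longrightarrow> relprime a u"
proof (rule relprimeI)
  fix h assume "u dvd 1" "a dvd u * h"
  then obtain v where v: "1 = u * v" by (auto elim: dvdE)
  have "a dvd v * (u * h)" using \<open>a dvd u * h\<close> by simp
  also have "v * (u * h) = h" using v by (metis mult.assoc mult.commute mult_1)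
  finally show "a dvd h" .
qed

lemma dvd_prod_diff:
  fixes f g :: "'b \<Rightarrow> 'a::comm_ring_1"
  assumes "\<And>t. t \<in> A \<Longrightarrow> d dvd f t - g t"
  shows "d dvd prod f A - prod g A"
  using assms
proof (induction A rule: infinite_finite_induct)
  case (insert a A)
  have "prod f (insert a A) - prod g (insert a A) = f a * (prod f A - prod g A) + (f a - g a) * prod g A"
    using insert by (simp add: algebra_simps)
  then show ?case using insert by simp
qed simp_all

text \<open>A Jacobian-type criterion. If the square of \<open>x\<close> divides
  \<open>r * q\<close>, then \<open>x\<close> divides \<open>D (r * q)\<close>, hence also
  \<open>r * D q\<close> because \<open>r\<close> divides \<open>D r\<close>. As \<open>q\<close> is
  prime to \<open>D q\<close>, this forces \<open>x\<close> to divide \<open>r\<close>; then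
  \<open>x\<close> is prime to \<open>q\<close>, and its square already divides
  \<open>r\<close>.\<close>

lemma squarefree_mult_derivation:
  fixes D :: "'a::idom \<Rightarrow> 'a"
  assumes D: "\<And>x y. D (x * y) = x * D y + y * D x"
    and r: "squarefree r" "r dvd D r" "r \<noteq> 0"
    and q: "relprime q r" "relprime q (D q)" "q \<noteq> 0"
  shows "squarefree (r * q)"
proof (rule squarefreeI)
  fix x assume "x\<^sup>2 dvd r * q"
  then obtain w where w: "r * q = x\<^sup>2 * w" by (auto simp: dvd_def)
  obtain e where e: "D r = r * e" using r(2) by (auto simp: dvd_def)
  have x0: "x \<noteq> 0" using w r q by auto
  have "r * D q = D (r * q) - r * q * e" by (simp add: D e algebra_simps)
  also have "\<dots> = x * (x * D w + 2 * w * D x - x * w * e)"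
    unfolding w power2_eq_square D by (simp add: algebra_simps)
  finally obtain v where v: "r * D q = x * v" by blast
  define u where "u = x * w"
  have u: "r * q = x * u" by (simp add: u_def w power2_eq_square mult.assoc)
  \<comment> \<open>Both sides equal \<open>q * r * D q\<close>.\<close>
  have "x * (q * v) = x * (D q * u)" using u v by (metis mult.left_commute mult.commute)
  then have "q dvd D q * u" using x0 by (metis dvd_triv_left mult_left_cancel)
  then obtain w' where w': "u = q * w'" using q(2) by (auto simp: dvd_def dest!: relprimeD)
  have "q * r = q * (x * w')" using u w' by (metis mult.left_commute mult.commute)
  then have rx: "r = x * w'" using q(3) by simp
  have "relprime x q" using q rx by (metis dvd_triv_left relprime_dvd_right relprime_sym)
  moreover have "x dvd q * w'" using w' u_def by (metis dvd_triv_left)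
  ultimately have "x dvd w'" by (rule relprimeD)
  then have "x\<^sup>2 dvd r" by (simp add: rx power2_eq_square)
  then show "x dvd 1" using r(1) by (rule squarefreeD[rotated])
qed

subsection \<open>Restricting a polynomial to a set of monomials\<close>

text \<open>This serves polynomials as sums of terms, and also exponent vectors as sums of multiples
  of unit vectors.\<close>

lemma poly_mapping_single_induct [case_names single add]:
  assumes "\<And>m c. Q (single m c)" and "\<And>a b. Q a \<Longrightarrow> Q b \<Longrightarrow> Q (a + b)"
  shows "Q (g :: 'b \<Rightarrow>\<^sub>0 'a::comm_monoid_add)"
proof (induction g rule: update_induct)
  case const then show ?case using assms(1)[of undefined 0] by simp
next
  case (update f a b)
  have "Poly_Mapping.update a b f = f + single a b"
    using update by (intro poly_mapping_eqI) (auto simp: lookup_update lookup_add lookup_single in_keys_iff when_def)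
  then show ?case using update assms by simp
qed

lemma poly_mapping_sum_single: "(g :: 'b \<Rightarrow>\<^sub>0 'a::comm_monoid_add) = (\<Sum>m\<in>keys g. single m (lookup g m))"
  by (rule poly_mapping_eqI) (auto simp: lookup_sum lookup_single when_def in_keys_iff)

text \<open>Homogeneous components, residues modulo a variable, the part of high degree in a
  variable, and the projection onto \<open>polys l\<close> are all instances.\<close>

lift_definition restr :: "('b \<Rightarrow> bool) \<Rightarrow> ('b \<Rightarrow>\<^sub>0 'a::zero) \<Rightarrow> 'b \<Rightarrow>\<^sub>0 'a" is
  "\<lambda>P f m. if P m then f m else 0"
  by (auto elim: finite_subset[rotated])

lemma lookup_restr: "lookup (restr P g) m = (if P m then lookup g m else 0)"
  by transfer simp

lemma keys_restr: "keys (restr P g) = {m \<in> keys g. P m}"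
  by (auto simp: in_keys_iff lookup_restr split: if_splits)

lemma restr_add: "restr P (a + b) = restr P a + restr P (b :: 'b \<Rightarrow>\<^sub>0 'a::monoid_add)"
  by (rule poly_mapping_eqI) (simp add: lookup_restr lookup_add)

lemma restr_diff: "restr P (a - b) = restr P a - restr P (b :: 'b \<Rightarrow>\<^sub>0 'a::ab_group_add)"
  by (rule poly_mapping_eqI) (simp add: lookup_restr lookup_minus)

lemma restr_single: "restr P (single m c) = (if P m then single m c else 0)"
  by (rule poly_mapping_eqI) (auto simp: lookup_restr lookup_single when_def)

lemma restr_sum: "restr P (sum f A) = (\<Sum>i\<in>A. restr P (f i :: 'b \<Rightarrow>\<^sub>0 'a::comm_monoid_add))"
  by (rule poly_mapping_eqI) (simp add: lookup_restr lookup_sum)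

lemma restr_eq_self: "(\<And>m. m \<in> keys g \<Longrightarrow> P m) \<Longrightarrow> restr P g = g"
  by (rule poly_mapping_eqI) (auto simp: lookup_restr in_keys_iff)

lemma restr_eq_0: "(\<And>m. m \<in> keys g \<Longrightarrow> \<not> P m) \<Longrightarrow> restr P g = 0"
  by (rule poly_mapping_eqI) (auto simp: lookup_restr in_keys_iff)

text \<open>Shifting by any monomial of \<open>a\<close> turns the condition \<open>P\<close> into
  \<open>Q\<close>, so the restriction is linear over such \<open>a\<close>. Extracting divisibility
  from selected monomials always goes through this rule.\<close>

lemma restr_mult:
  fixes a b :: "'b::comm_monoid_add \<Rightarrow>\<^sub>0 'a::comm_semiring_1"
  assumes "\<And>m m'. m \<in> keys a \<Longrightarrow> P (m + m') = Q m'"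
  shows "restr P (a * b) = a * restr Q b"
proof (induction b rule: poly_mapping_single_induct)
  case (single m' c)
  have "restr P (a * single m' c) = restr P ((\<Sum>m\<in>keys a. single m (lookup a m)) * single m' c)"
    using poly_mapping_sum_single[of a] by simp
  also have "\<dots> = (\<Sum>m\<in>keys a. single m (lookup a m) * restr Q (single m' c))"
    using assms by (auto simp: sum_distrib_right mult_single restr_sum restr_single intro!: sum.cong)
  also have "\<dots> = a * restr Q (single m' c)"
    using poly_mapping_sum_single[of a] by (simp flip: sum_distrib_right)
  finally show ?case .
qed (simp add: restr_add distrib_left)

subsection \<open>Polynomials not involving a given variable\<close>

definition var_free :: "nat \<Rightarrow> 'a::comm_ring_1 mpoly \<Rightarrow> bool" where
  "var_free j g \<longleftrightarrow> (\<forall>m\<in>keys g. lookup m j = 0)"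

lemma var_free_diff: "var_free j a \<Longrightarrow> var_free j b \<Longrightarrow> var_free j (a - b)"
  using keys_diff[of a b] by (auto simp: var_free_def)

lemma var_free_1 [simp]: "var_free j 1"
  by (simp add: var_free_def)

lemma var_free_mult: "var_free j a \<Longrightarrow> var_free j b \<Longrightarrow> var_free j (a * b)"
  using keys_mult[of a b] by (fastforce simp: var_free_def lookup_add)

lemma var_free_power: "var_free j a \<Longrightarrow> var_free j (a ^ e)"
  by (induction e) (auto intro: var_free_mult)

lemma var_free_pvar: "i \<noteq> j \<Longrightarrow> var_free j (pvar i)"
  by (simp add: var_free_def pvar_def lookup_single)

lemma var_free_prod: "(\<And>i. i \<in> A \<Longrightarrow> var_free j (f i)) \<Longrightarrow> var_free j (prod f A)"
  by (induction A rule: infinite_finite_induct) (auto intro: var_free_mult)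

lemmas var_free_intros =
  var_free_diff var_free_mult var_free_power var_free_pvar var_free_prod var_free_1

lemma pvar_power: "pvar i ^ e = single (single i e) 1"
  by (induction e) (simp_all add: pvar_def mult_single flip: single_add)

lemma pvar_neq_0 [simp]: "pvar i \<noteq> 0"
  by (simp add: pvar_def flip: keys_eq_empty)

lemma pvar_power_dvd:
  assumes "\<And>m. m \<in> keys g \<Longrightarrow> e \<le> lookup m j"
  shows "pvar j ^ e dvd g"
proof -
  have "pvar j ^ e dvd single m (lookup g m)" if "m \<in> keys g" for m
  proof -
    have "single m (lookup g m) = pvar j ^ e * single (m - single j e) (lookup g m)"
    proof -
      have "single j e + (m - single j e) = m"
        using assms[OF that]
        by (intro poly_mapping_eqI) (auto simp: lookup_add lookup_minus lookup_single when_def)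
      then show ?thesis by (simp add: pvar_power mult_single)
    qed
    then show ?thesis by simp
  qed
  then show ?thesis by (subst poly_mapping_sum_single) (rule dvd_sum)
qed

text \<open>Since \<open>r\<close> does not involve \<open>x_j\<close>, the part of
  \<open>r * w\<close> of degree at least \<open>e\<close> in \<open>x_j\<close> is \<open>r\<close>
  times that part of \<open>w\<close>, which is divisible by the power of \<open>x_j\<close> to be
  cancelled.\<close>

lemma var_free_mult_cancel:
  fixes r :: "'a::idom mpoly"
  assumes "var_free j r" "pvar j ^ e * h = restr (\<lambda>m. e \<le> lookup m j) (r * w)"
  shows "r dvd h"
proof -
  have "pvar j ^ e * h = r * restr (\<lambda>m. e \<le> lookup m j) w"
    unfolding assms(2) using assms(1) by (intro restr_mult) (simp add: var_free_def lookup_add)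
  moreover have "pvar j ^ e dvd restr (\<lambda>m. e \<le> lookup m j) w"
    by (rule pvar_power_dvd) (simp add: keys_restr)
  then obtain v where "restr (\<lambda>m. e \<le> lookup m j) w = pvar j ^ e * v" by (auto simp: dvd_def)
  ultimately have "pvar j ^ e * h = pvar j ^ e * (r * v)" by (simp add: mult.left_commute)
  then show ?thesis by simp
qed

lemma restr_pvar_power: "restr (\<lambda>m. e \<le> lookup m j) (pvar j ^ e * h) = pvar j ^ e * h"
proof -
  have "restr (\<lambda>m. e \<le> lookup m j) (pvar j ^ e * h) = pvar j ^ e * restr (\<lambda>_. True) h"
    by (rule restr_mult) (simp add: pvar_power lookup_add)
  then show ?thesis by (simp add: restr_eq_self)
qed

lemma relprime_var_free_pvar:
  fixes r :: "'a::idom mpoly"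
  assumes "var_free j r"
  shows "relprime r (pvar j)"
proof (rule relprimeI)
  fix h assume "r dvd pvar j * h"
  then obtain w where "pvar j * h = r * w" by (auto simp: dvd_def)
  then have "pvar j ^ 1 * h = restr (\<lambda>m. 1 \<le> lookup m j) (r * w)"
    using restr_pvar_power[of 1 j h] by simp
  then show "r dvd h" by (rule var_free_mult_cancel[OF assms])
qed

lemma relprime_var_free_monic:
  fixes r :: "'a::idom mpoly"
  assumes "var_free j r" "var_free j u" "n > 0"
  shows "relprime r (u - pvar j ^ n)"
proof (rule relprimeI)
  \<comment> \<open>Modulo \<open>r\<close> we have \<open>x\<^sup>n h = u h\<close>, hence \<open>x\<^bsup>nN\<^esup> h = u\<^sup>N h\<close>; for large \<open>N\<close> the two sides have no
    exponent of \<open>x\<close> in common.\<close>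
  fix h assume rh: "r dvd (u - pvar j ^ n) * h"
  define N where "N = Suc (Max (insert 0 ((\<lambda>m. lookup m j) ` keys h)))"
  have N: "lookup m j < N" if "m \<in> keys h" for m
    using that by (auto simp: N_def less_Suc_eq_le)
  define T :: "'a mpoly \<Rightarrow> 'a mpoly" where "T = restr (\<lambda>m. n * N \<le> lookup m j)"
  have "u - pvar j ^ n dvd u ^ N - (pvar j ^ n) ^ N"
    by (metis power_diff_sumr2 dvd_triv_left)
  then have "(u - pvar j ^ n) * h dvd (u ^ N - (pvar j ^ n) ^ N) * h"
    by (rule mult_dvd_mono) simp
  then have "r dvd (u ^ N - (pvar j ^ n) ^ N) * h" using rh by (rule dvd_trans[rotated])
  then have "r dvd pvar j ^ (n * N) * h - u ^ N * h"
    by (metis dvd_minus_iff left_diff_distrib minus_diff_eq power_mult)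
  then obtain w where "pvar j ^ (n * N) * h - u ^ N * h = r * w" by (auto simp: dvd_def)
  then have "T (pvar j ^ (n * N) * h) - T (u ^ N * h) = T (r * w)"
    by (metis T_def restr_diff)
  moreover have "T (u ^ N * h) = u ^ N * T h"
    unfolding T_def using var_free_power[OF assms(2), of N]
    by (intro restr_mult) (simp add: var_free_def lookup_add)
  moreover have "T h = 0"
    unfolding T_def
  proof (rule restr_eq_0)
    fix m assume "m \<in> keys h"
    then have "lookup m j < N" by (rule N)
    also have "N \<le> n * N" using assms(3) by simp
    finally show "\<not> n * N \<le> lookup m j" by simp
  qed
  moreover have "T (pvar j ^ (n * N) * h) = pvar j ^ (n * N) * h"
    unfolding T_def by (rule restr_pvar_power)
  ultimately have "pvar j ^ (n * N) * h = restr (\<lambda>m. n * N \<le> lookup m j) (r * w)"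
    by (simp add: T_def)
  then show "r dvd h" by (rule var_free_mult_cancel[OF assms(1)])
qed

lemma pvar_not_unit: "\<not> pvar i dvd (1 :: 'a::comm_ring_1 mpoly)"
proof
  assume "pvar i dvd (1 :: 'a mpoly)"
  then obtain h where h: "pvar i ^ 1 * h = (1 :: 'a mpoly)" by (auto elim!: dvdE)
  have "(1 :: 'a mpoly) = restr (\<lambda>m. 1 \<le> lookup m i) 1"
    using restr_pvar_power[of 1 i h] unfolding h by simp
  also have "\<dots> = 0" by (rule restr_eq_0) simp
  finally show False by simp
qed

lemma relprime_pvar_pvar:
  "i \<noteq> j \<Longrightarrow> relprime (pvar i) (pvar j :: 'a::idom mpoly)"
  by (intro relprime_var_free_pvar var_free_pvar)

subsection \<open>Partial derivatives\<close>

lift_definition pd :: "nat \<Rightarrow> 'a::comm_ring_1 mpoly \<Rightarrow> 'a mpoly" is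
  "\<lambda>j f m. of_nat (Suc (lookup m j)) * f (m + single j 1)"
proof -
  fix j and f :: "(nat \<Rightarrow>\<^sub>0 nat) \<Rightarrow> 'a"
  assume "finite {m. f m \<noteq> 0}"
  then have "finite ((\<lambda>m. m + single j 1) -` {m. f m \<noteq> 0})"
    by (rule finite_vimageI) (simp add: inj_on_def)
  then show "finite {m. of_nat (Suc (lookup m j)) * f (m + single j 1) \<noteq> 0}"
    by (rule finite_subset[rotated]) auto
qed

lemma lookup_pd: "lookup (pd j g) m = of_nat (Suc (lookup m j)) * lookup g (m + single j 1)"
  by transfer simp

lemma keys_pd: "m \<in> keys (pd j g) \<Longrightarrow> m + single j 1 \<in> keys g"
  by (auto simp: in_keys_iff lookup_pd simp del: of_nat_Suc)

lemma pd_add: "pd j (a + b) = pd j a + pd j b"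
  by (rule poly_mapping_eqI) (simp add: lookup_pd lookup_add algebra_simps)

lemma pd_diff: "pd j (a - b) = pd j a - pd j b"
  by (rule poly_mapping_eqI) (simp add: lookup_pd lookup_minus algebra_simps)

text \<open>If the exponent of \<open>x_j\<close> is 0, the truncated subtraction leaves
  \<open>m\<close> unchanged, but the coefficient is then 0.\<close>

lemma pd_single: "pd j (single m c) = single (m - single j 1) (of_nat (lookup m j) * c)"
proof (rule poly_mapping_eqI)
  fix m'
  have 1: "m' + single j 1 = m \<longleftrightarrow> m - single j 1 = m' \<and> lookup m j > 0"
  proof safe
    assume *: "lookup m j > 0"
    show "m - single j 1 + single j 1 = m"
      by (rule poly_mapping_eqI) (use * in \<open>auto simp: lookup_add lookup_minus lookup_single when_def\<close>)
  qed (auto simp: lookup_add)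
  show "lookup (pd j (single m c)) m' = lookup (single (m - single j 1) (of_nat (lookup m j) * c)) m'"
  proof (cases "lookup m j > 0")
    case True
    then show ?thesis using 1
      by (auto simp: lookup_pd lookup_single when_def lookup_add simp del: of_nat_Suc)
  next
    case False
    then show ?thesis using 1
      by (auto simp: lookup_pd lookup_single when_def simp del: of_nat_Suc)
  qed
qed

lemma pd_mult: "pd j (a * b) = a * pd j b + b * pd j a"
proof (induction a rule: poly_mapping_single_induct)
  case (single m c)
  show ?case
  proof (induction b rule: poly_mapping_single_induct)
    case (single m' c')
    \<comment> \<open>Truncated subtraction commutes with adding \<open>p\<close> if the exponent of
      \<open>x_j\<close> in \<open>q\<close> is positive; otherwise both coefficients
      vanish.\<close>
    have shift: "single (p + q - single j 1) (of_nat (lookup q j) * d) =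
      single (p + (q - single j 1)) (of_nat (lookup q j) * d :: 'a)" for p q d
    proof (cases "lookup q j > 0")
      case True
      then have "p + q - single j 1 = p + (q - single j 1)"
        by (intro poly_mapping_eqI) (auto simp: lookup_add lookup_minus lookup_single when_def)
      then show ?thesis by simp
    qed simp
    have "single m c * pd j (single m' c') = single (m + m' - single j 1) (of_nat (lookup m' j) * (c * c'))"
      unfolding shift by (simp add: pd_single mult_single mult.left_commute)
    moreover have "single m' c' * pd j (single m c) = single (m' + m - single j 1) (of_nat (lookup m j) * (c * c'))"
      unfolding shift by (simp add: pd_single mult_single mult_ac)
    ultimately show ?case
      by (simp add: mult_single pd_single lookup_add add.commute distrib_right flip: single_add)
  qed (simp add: pd_add algebra_simps)
qed (simp add: pd_add algebra_simps)

lemma pd_pconst [simp]: "pd j (pconst c) = 0"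
  by (simp add: pconst_def pd_single)

lemma pd_pvar: "pd j (pvar i) = (if i = j then 1 else 0)"
  by (simp add: pvar_def pd_single lookup_single when_def)

lemma pd_var_free:
  assumes "var_free j g"
  shows "pd j g = 0"
proof -
  have "m \<notin> keys (pd j g)" for m
  proof
    assume "m \<in> keys (pd j g)"
    then have "lookup (m + single j 1) j = 0"
      using keys_pd assms unfolding var_free_def by blast
    then show False by (simp add: lookup_add)
  qed
  then show ?thesis by (intro poly_mapping_eqI) (simp add: in_keys_iff)
qed

text \<open>When a variable \<open>x_a\<close> is adjoined, the derivation \<open>pd a\<close> kills
  the old product and sends \<open>x_a\<close> to 1, so the derivation criterion applies.\<close>

lemma squarefree_prod_pvar:
  "finite A \<Longrightarrow> squarefree (\<Prod>i\<in>A. pvar i :: 'a::idom mpoly)"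
proof (induction A rule: finite_induct)
  case (insert a A)
  have free: "var_free a (\<Prod>i\<in>A. pvar i :: 'a mpoly)"
    using insert by (intro var_free_prod var_free_pvar) auto
  have "squarefree ((\<Prod>i\<in>A. pvar i) * pvar a :: 'a mpoly)"
  proof (rule squarefree_mult_derivation[of "pd a"])
    show "relprime (pvar a) (\<Prod>i\<in>A. pvar i :: 'a mpoly)"
      using insert by (intro relprime_prod_right relprime_pvar_pvar) auto
  qed (use insert free in \<open>simp_all add: pd_mult pd_var_free pd_pvar\<close>)
  then show ?case using insert by (simp add: mult.commute)
qed (auto simp: squarefree_def power2_eq_square dest: dvd_mult_left)

lemma pconst_mult: "pconst (a * b) = pconst a * pconst b"
  by (simp add: pconst_def mult_single)

lemma pconst_1 [simp]: "pconst 1 = 1"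
  by (simp add: pconst_def)

lemma pconst_of_nat [simp]: "pconst (of_nat n) = of_nat n"
  by (simp add: pconst_def)

lemma pconst_inverse_of_nat:
  "n > 0 \<Longrightarrow> pconst (1 / of_nat n :: 'a::field_char_0) * of_nat n = 1"
  using pconst_mult[of "1 / of_nat n :: 'a" "of_nat n"] by simp

subsection \<open>Vector fields\<close>

definition vf :: "nat \<Rightarrow> (nat \<Rightarrow> 'a::comm_ring_1 mpoly) \<Rightarrow> 'a mpoly \<Rightarrow> 'a mpoly" where
  "vf l g f = (\<Sum>j\<le>l. g j * pd j f)"

lemma vf_add: "vf l g (a + b) = vf l g a + vf l g b"
  by (simp add: vf_def pd_add distrib_left sum.distrib)

lemma vf_diff: "vf l g (a - b) = vf l g a - vf l g b"
  by (simp add: vf_def pd_diff right_diff_distrib sum_subtractf)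

lemma vf_0 [simp]: "vf l g 0 = 0"
  using vf_diff[of l g 0 0] by simp

lemma vf_mult: "vf l g (a * b) = a * vf l g b + b * vf l g a"
  by (simp add: vf_def pd_mult distrib_left sum.distrib sum_distrib_left mult_ac)

lemma vf_pconst [simp]: "vf l g (pconst c) = 0"
  by (simp add: vf_def)

lemma vf_1 [simp]: "vf l g 1 = 0"
  using vf_pconst[of l g 1] by simp

lemma vf_pvar: "i \<le> l \<Longrightarrow> vf l g (pvar i) = g i"
  by (simp add: vf_def pd_pvar if_distrib cong: if_cong)

lemma vf_power: "vf l g (a ^ e) = of_nat e * a ^ (e - 1) * vf l g a"
proof (induction e)
  case (Suc e)
  then show ?case by (cases e) (simp_all add: vf_mult algebra_simps)
qed simp

lemma vf_combination: "vf l (\<lambda>j. \<Sum>i\<in>A. c i * g i j) f = (\<Sum>i\<in>A. c i * vf l (g i) f)"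
  unfolding vf_def sum_distrib_right sum_distrib_left by (subst sum.swap) (simp add: mult.assoc)

lemma vf_diff_left: "vf l (\<lambda>j. g j - h j) f = vf l g f - vf l h f"
  by (simp add: vf_def left_diff_distrib sum_subtractf)

lemma vf_scale: "vf l (\<lambda>j. c * g j) f = c * vf l g f"
  by (simp add: vf_def sum_distrib_left mult.assoc)

lemma vf_cong: "(\<And>j. j \<le> l \<Longrightarrow> g j = h j) \<Longrightarrow> vf l g f = vf l h f"
  by (simp add: vf_def)

lemma vf_dvd_mult: "a dvd vf l g a \<Longrightarrow> b dvd vf l g b \<Longrightarrow> a * b dvd vf l g (a * b)"
  unfolding vf_mult by (metis dvd_add dvd_refl mult.commute mult_dvd_mono)

lemma vf_dvd_prod: "(\<And>i. i \<in> A \<Longrightarrow> h i dvd vf l g (h i)) \<Longrightarrow> prod h A dvd vf l g (prod h A)"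
  by (induction A rule: infinite_finite_induct) (auto intro: vf_dvd_mult)

text \<open>By the Leibniz rule, modulo \<open>q\<close> only \<open>r * vf l g q\<close> survives,
  and \<open>r\<close> can be cancelled there.\<close>

lemma dvd_vf_factor:
  assumes "q * r dvd vf l g (q * r)" "relprime q r"
  shows "q dvd vf l g q"
proof (rule relprimeD[OF assms(2)])
  have "q dvd q * vf l g r + r * vf l g q"
    using assms(1) unfolding vf_mult by (rule dvd_mult_left)
  then show "q dvd r * vf l g q" by (simp add: dvd_add_right_iff)
qed

subsection \<open>The subring of polynomials in finitely many variables\<close>

lemma keys_add_nat: "keys (a + b :: 'b \<Rightarrow>\<^sub>0 nat) = keys a \<union> keys b"
  by (auto simp: in_keys_iff lookup_add)

lemma polys_add: "a \<in> polys l \<Longrightarrow> b \<in> polys l \<Longrightarrow> a + b \<in> polys l"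
  using keys_add[of a b] by (auto simp: polys_def)

lemma polys_diff: "a \<in> polys l \<Longrightarrow> b \<in> polys l \<Longrightarrow> a - b \<in> polys l"
  using keys_diff[of a b] by (auto simp: polys_def)

lemma polys_mult: "a \<in> polys l \<Longrightarrow> b \<in> polys l \<Longrightarrow> a * b \<in> polys l"
  using keys_mult[of a b] by (fastforce simp: polys_def keys_add_nat)

lemma polys_0: "0 \<in> polys l"
  by (simp add: polys_def)

lemma polys_single: "keys m \<subseteq> {0..l} \<Longrightarrow> single m c \<in> polys l"
  by (auto simp: polys_def)

lemma polys_pconst: "pconst c \<in> polys l"
  by (simp add: pconst_def polys_single)

lemma polys_1: "1 \<in> polys l"
  using polys_pconst[of 1] by simp

lemma polys_pvar: "i \<le> l \<Longrightarrow> pvar i \<in> polys l"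
  by (simp add: pvar_def polys_single)

lemma polys_power: "a \<in> polys l \<Longrightarrow> a ^ e \<in> polys l"
  by (induction e) (auto intro: polys_mult polys_1)

lemma polys_prod: "(\<And>i. i \<in> A \<Longrightarrow> h i \<in> polys l) \<Longrightarrow> prod h A \<in> polys l"
  by (induction A rule: infinite_finite_induct) (auto intro: polys_mult polys_1)

lemma polys_sum: "(\<And>i. i \<in> A \<Longrightarrow> h i \<in> polys l) \<Longrightarrow> sum h A \<in> polys l"
  by (induction A rule: infinite_finite_induct) (auto intro: polys_add polys_0)

lemmas polys_intros = polys_diff polys_mult polys_0 polys_1 polys_pconst polys_pvar polys_power polys_prod

lemma polys_pd:
  assumes "f \<in> polys l"
  shows "pd j f \<in> polys l"
proof -
  have "keys m \<subseteq> {0..l}" if "m \<in> keys (pd j f)" for m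
  proof -
    have "keys (m + single j 1) \<subseteq> {0..l}" using keys_pd[OF that] assms unfolding polys_def by blast
    then show ?thesis by (simp add: keys_add_nat)
  qed
  then show ?thesis by (simp add: polys_def)
qed

lemma polys_vf: "(\<And>j. j \<le> l \<Longrightarrow> g j \<in> polys l) \<Longrightarrow> f \<in> polys l \<Longrightarrow> vf l g f \<in> polys l"
  unfolding vf_def by (auto intro!: polys_sum polys_mult polys_pd)

text \<open>A \<open>polys l\<close>-linear retraction of the ambient ring onto
  \<open>polys l\<close>. It brings quotients and coefficients found in the ambient ring back into
  \<open>polys l\<close>.\<close>

abbreviation restr_polys :: "nat \<Rightarrow> 'a::comm_ring_1 mpoly \<Rightarrow> 'a mpoly" where
  "restr_polys l \<equiv> restr (\<lambda>m. keys m \<subseteq> {0..l})"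

lemma restr_polys_in: "restr_polys l g \<in> polys l"
  by (auto simp: polys_def keys_restr)

lemma restr_polys_eq: "g \<in> polys l \<Longrightarrow> restr_polys l g = g"
  by (rule restr_eq_self) (auto simp: polys_def)

lemma restr_polys_mult: "a \<in> polys l \<Longrightarrow> restr_polys l (a * b) = a * restr_polys l b"
  by (rule restr_mult) (auto simp: polys_def keys_add_nat)

lemma polys_cofactor:
  fixes f :: "'a::idom mpoly"
  assumes "f \<in> polys l" "f \<noteq> 0" "f * h \<in> polys l"
  shows "h \<in> polys l"
proof -
  have "f * h = f * restr_polys l h"
    using restr_polys_mult[OF assms(1), of h] restr_polys_eq[OF assms(3)] by simp
  then have "h = restr_polys l h" using assms(2) by simp
  then show ?thesis by (metis restr_polys_in)
qed

lemma vf_derivation: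
  assumes "\<And>j. j \<le> l \<Longrightarrow> g j \<in> polys l"
  shows "vf l g \<in> derivations l"
  using assms by (auto simp: derivations_def vf_add vf_mult intro: polys_vf)

text \<open>Both sides are derivations with the same values on the variables; agreement passes to
  powers, monomials, scalar multiples and finite sums.\<close>

lemma derivation_eq_vf:
  fixes f :: "'a::comm_ring_1 mpoly"
  assumes "\<delta> \<in> derivations l" "f \<in> polys l"
  shows "\<delta> f = vf l (\<lambda>j. \<delta> (pvar j)) f"
proof -
  have add: "\<delta> (g + h) = \<delta> g + \<delta> h" and mult: "\<delta> (g * h) = g * \<delta> h + h * \<delta> g"
    and scale: "\<delta> (pconst c * g) = pconst c * \<delta> g"
    if "g \<in> polys l" "h \<in> polys l" for g h c
    using assms(1) that by (auto simp: derivations_def)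
  define D where "D = vf l (\<lambda>j. \<delta> (pvar j))"
  have one: "\<delta> 1 = 0" using mult[OF polys_1 polys_1] by simp
  have zero: "\<delta> 0 = 0" using add[OF polys_0 polys_0] by simp
  have pow: "\<delta> (pvar i ^ e) = D (pvar i ^ e)" if "i \<le> l" for i e
  proof (induction e)
    case (Suc e)
    then show ?case using that
      by (simp add: mult polys_pvar polys_power D_def vf_mult vf_pvar)
  qed (simp add: one D_def)
  have mono: "keys m \<subseteq> {0..l} \<longrightarrow> \<delta> (single m 1) = D (single m 1)" for m
  proof (induction m rule: poly_mapping_single_induct)
    case (single i e)
    then show ?case using pow[of i e]
      by (cases "e = 0") (auto simp: one D_def simp flip: pvar_power)
  next
    case (add a b)
    have "single (a + b) (1::'a) = single a 1 * single b 1" by (simp add: mult_single)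
    then show ?case
      using add by (auto simp: keys_add_nat mult polys_single D_def vf_mult)
  qed
  have sing: "\<delta> (single m c) = D (single m c)" if "keys m \<subseteq> {0..l}" for m c
  proof -
    have "single m c = pconst c * single m 1" by (simp add: pconst_def mult_single)
    then show ?thesis using mono[of m] that scale[OF polys_single[OF that, of 1] polys_0, of c]
      by (simp add: D_def vf_mult)
  qed
  have "\<delta> (\<Sum>m\<in>A. single m (c m)) = D (\<Sum>m\<in>A. single m (c m))"
    if "finite A" "\<And>m. m \<in> A \<Longrightarrow> keys m \<subseteq> {0..l}" for A c
    using that
  proof (induction A rule: finite_induct)
    case (insert m A)
    then show ?case
      by (simp add: add polys_single polys_sum sing) (simp add: D_def vf_add)
  qed (simp add: D_def zero)
  from this[of "keys f" "lookup f"] assms(2) show ?thesis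
    by (simp add: polys_def D_def flip: poly_mapping_sum_single)
qed

subsection \<open>Homogeneity\<close>

definition mdeg :: "(nat \<Rightarrow>\<^sub>0 nat) \<Rightarrow> nat" where
  "mdeg m = (\<Sum>i\<in>keys m. lookup m i)"

lemma mdeg_eq_sum: "finite A \<Longrightarrow> keys m \<subseteq> A \<Longrightarrow> mdeg m = (\<Sum>i\<in>A. lookup m i)"
  unfolding mdeg_def by (rule sum.mono_neutral_left) (auto simp: in_keys_iff)

lemma mdeg_add: "mdeg (a + b) = mdeg a + mdeg b"
  using mdeg_eq_sum[of "keys a \<union> keys b" a] mdeg_eq_sum[of "keys a \<union> keys b" b]
  by (simp add: mdeg_def keys_add_nat lookup_add sum.distrib)

lemma mdeg_single [simp]: "mdeg (single i e) = e"
  by (simp add: mdeg_def)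

lemma homogeneous_alt: "homogeneous d g \<longleftrightarrow> (\<forall>m\<in>keys g. mdeg m = d)"
  by (simp add: homogeneous_def mdeg_def)

lemma homogeneous_0: "homogeneous d 0"
  by (simp add: homogeneous_alt)

lemma homogeneous_add: "homogeneous d a \<Longrightarrow> homogeneous d b \<Longrightarrow> homogeneous d (a + b)"
  using keys_add[of a b] by (auto simp: homogeneous_alt)

lemma homogeneous_diff: "homogeneous d a \<Longrightarrow> homogeneous d b \<Longrightarrow> homogeneous d (a - b)"
  using keys_diff[of a b] by (auto simp: homogeneous_alt)

lemma homogeneous_mult: "homogeneous d a \<Longrightarrow> homogeneous e b \<Longrightarrow> homogeneous (d + e) (a * b)"
  using keys_mult[of a b] by (fastforce simp: homogeneous_alt mdeg_add)

lemma homogeneous_sum: "(\<And>i. i \<in> A \<Longrightarrow> homogeneous d (h i)) \<Longrightarrow> homogeneous d (sum h A)"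
  by (induction A rule: infinite_finite_induct) (auto intro: homogeneous_add homogeneous_0)

lemma homogeneous_1: "homogeneous 0 1"
  by (simp add: homogeneous_alt mdeg_def)

lemma homogeneous_pconst: "homogeneous 0 (pconst c)"
  by (simp add: homogeneous_alt mdeg_def pconst_def)

lemma homogeneous_pvar_power: "homogeneous e (pvar i ^ e)"
  by (simp add: homogeneous_alt pvar_power)

lemma homogeneous_pvar: "homogeneous 1 (pvar i)"
  using homogeneous_pvar_power[of 1 i] by simp

lemma homogeneous_prod:
  "(\<And>i. i \<in> A \<Longrightarrow> homogeneous (d i) (h i)) \<Longrightarrow> homogeneous (sum d A) (prod h A)"
  by (induction A rule: infinite_finite_induct) (auto intro: homogeneous_mult homogeneous_1)

text \<open>The factor \<open>pvar i\<close> restores the degree lost by differentiation, which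
  avoids a truncated \<open>d - 1\<close>.\<close>

lemma homogeneous_pvar_pd: "homogeneous d f \<Longrightarrow> homogeneous d (pvar i * pd j f)"
  using keys_mult[of "pvar i" "pd j f"] keys_pd[of _ j f]
  by (fastforce simp: homogeneous_alt pvar_def mdeg_add)

text \<open>The component of \<open>f * h\<close> of degree \<open>d + e\<close> is \<open>f\<close>
  times the component of \<open>h\<close> of degree \<open>e\<close>; then \<open>f\<close> is
  cancelled.\<close>

lemma homogeneous_cofactor:
  fixes f :: "'a::idom mpoly"
  assumes "homogeneous d f" "f \<noteq> 0" "homogeneous (d + e) (f * h)"
  shows "homogeneous e h"
proof -
  have "f * h = restr (\<lambda>m. mdeg m = d + e) (f * h)"
    using assms(3) by (simp add: homogeneous_alt restr_eq_self)
  also have "\<dots> = f * restr (\<lambda>m. mdeg m = e) h"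
    using assms(1) by (intro restr_mult) (simp add: homogeneous_alt mdeg_add)
  finally have "h = restr (\<lambda>m. mdeg m = e) h" using assms(2) by simp
  then show ?thesis unfolding homogeneous_alt by (metis (mono_tags, lifting) keys_restr mem_Collect_eq)
qed

lemma pvar_pd_single: "pvar j * pd j (single m c) = of_nat (lookup m j) * single m c"
proof (cases "lookup m j = 0")
  case False
  then have "single j 1 + (m - single j 1) = m"
    by (intro poly_mapping_eqI) (auto simp: lookup_add lookup_minus lookup_single when_def)
  then show ?thesis
    by (simp add: pd_single pvar_def mult_single flip: single_of_nat del: One_nat_def)
qed (simp add: pd_single)

lemma euler_homogeneous:
  fixes f :: "'a::comm_ring_1 mpoly"
  assumes "homogeneous d f" "f \<in> polys l"
  shows "vf l pvar f = of_nat d * f"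
proof -
  have pd_sum: "pd j (sum h A) = (\<Sum>i\<in>A. pd j (h i))" for j A and h :: "_ \<Rightarrow> 'a mpoly"
    by (rule poly_mapping_eqI) (simp add: lookup_pd lookup_sum sum_distrib_left)
  have "vf l pvar f = (\<Sum>j\<le>l. pvar j * pd j (\<Sum>m\<in>keys f. single m (lookup f m)))"
    unfolding vf_def by (simp flip: poly_mapping_sum_single)
  also have "\<dots> = (\<Sum>m\<in>keys f. \<Sum>j\<le>l. of_nat (lookup m j) * single m (lookup f m))"
    unfolding pd_sum sum_distrib_left by (subst sum.swap) (simp add: pvar_pd_single)
  also have "\<dots> = (\<Sum>m\<in>keys f. of_nat d * single m (lookup f m))"
  proof (rule sum.cong)
    fix m assume m: "m \<in> keys f"
    have "(\<Sum>j\<le>l. lookup m j) = mdeg m"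
      using assms(2) m by (intro mdeg_eq_sum[symmetric]) (fastforce simp: polys_def)+
    also have "\<dots> = d" using assms(1) m by (simp add: homogeneous_alt)
    finally show "(\<Sum>j\<le>l. of_nat (lookup m j) * single m (lookup f m)) = of_nat d * single m (lookup f m)"
      by (simp flip: sum_distrib_right of_nat_sum)
  qed simp
  also have "\<dots> = of_nat d * f"
    using poly_mapping_sum_single[of f] by (simp flip: sum_distrib_left)
  finally show ?thesis .
qed

subsection \<open>From logarithmic vector fields to derivations annihilating the equation\<close>

text \<open>Fields tangent to \<open>f\<close> split into multiples of the Euler field and fields
  without an \<open>x_0\<close>-component. Correcting each field of a basis of the latter by a
  multiple of the Euler field makes it annihilate \<open>f\<close> without changing its
  degree.\<close>

lemma Der0_basis:
  fixes f :: "'a::field_char_0 mpoly"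
  assumes f: "f \<in> polys l" "homogeneous d f" "f \<noteq> 0" "d > 0"
    and pol: "\<And>i j. i < r \<Longrightarrow> j \<le> l \<Longrightarrow> \<theta> i j \<in> polys l"
    and hom: "\<And>i j. i < r \<Longrightarrow> j \<le> l \<Longrightarrow> homogeneous (e i) (\<theta> i j)"
    and x0: "\<And>i. i < r \<Longrightarrow> \<theta> i 0 = 0"
    and log: "\<And>i. i < r \<Longrightarrow> f dvd vf l (\<theta> i) f"
    and dvd_x0: "\<And>g. f dvd vf l g f \<Longrightarrow> pvar 0 dvd g 0"
    and span: "\<And>g. f dvd vf l g f \<Longrightarrow> g 0 = 0 \<Longrightarrow> \<exists>c. \<forall>j\<in>{1..l}. g j = (\<Sum>i<r. c i * \<theta> i j)"
    and indep: "\<And>c. \<forall>j\<in>{1..l}. (\<Sum>i<r. c i * \<theta> i j) = 0 \<Longrightarrow> \<forall>i<r. c i = 0"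
  shows "\<exists>\<psi>. derivation_basis l (Der0 l f) r \<psi> \<and> (\<forall>i<r. homogeneous_derivation l (e i) (\<psi> i))"
proof -
  have "\<forall>i\<in>{..<r}. \<exists>h. vf l (\<theta> i) f = f * h" using log by (auto simp: dvd_def)
  then obtain h where h: "\<And>i. i < r \<Longrightarrow> vf l (\<theta> i) f = f * h i"
    by (auto dest!: bchoice)
  define q :: "'a mpoly" where "q = pconst (1 / of_nat d)"
  have q: "q * of_nat d = 1" unfolding q_def using f(4) by (rule pconst_inverse_of_nat)
  \<comment> \<open>The Euler field multiplies \<open>f\<close> by \<open>d\<close>, so subtracting
    \<open>h i / d\<close> times it cancels the value \<open>f * h i\<close>.\<close>
  define \<psi> where "\<psi> = (\<lambda>i j. \<theta> i j - q * h i * pvar j)"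
  have vf_E: "vf l pvar f = of_nat d * f" using f by (intro euler_homogeneous)
  have h_pol: "h i \<in> polys l" if "i < r" for i
    using polys_vf[of l "\<theta> i" f] pol[OF that] f h[OF that] by (metis polys_cofactor)
  have \<psi>_pol: "\<psi> i j \<in> polys l" if "i < r" "j \<le> l" for i j
    unfolding \<psi>_def q_def using that pol h_pol by (intro polys_intros) auto
  have \<psi>_hom: "homogeneous (e i) (\<psi> i j)" if "i < r" "j \<le> l" for i j
  proof -
    \<comment> \<open>The degree of \<open>h i\<close> may formally be \<open>e i - 1\<close>; the
      product with \<open>pvar j\<close> is treated as a whole so that this subtraction never
      appears.\<close>
    have "f * (pvar j * h i) = pvar j * vf l (\<theta> i) f"
      by (simp add: h[OF that(1)] mult.left_commute)
    also have "\<dots> = (\<Sum>m\<le>l. \<theta> i m * (pvar j * pd m f))"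
      unfolding vf_def by (simp add: sum_distrib_left mult_ac)
    also have "homogeneous (e i + d) \<dots>"
      using that f hom by (intro homogeneous_sum homogeneous_mult homogeneous_pvar_pd) auto
    finally have "homogeneous (d + e i) (f * (pvar j * h i))" by (simp only: add.commute)
    then have "homogeneous (e i) (pvar j * h i)"
      by (rule homogeneous_cofactor[OF f(2,3)])
    then have "homogeneous (0 + e i) (q * (pvar j * h i))"
      unfolding q_def by (intro homogeneous_mult homogeneous_pconst)
    then show ?thesis
      unfolding \<psi>_def using hom[OF that] by (intro homogeneous_diff) (simp_all add: mult_ac)
  qed
  have \<psi>_f: "vf l (\<psi> i) f = 0" if "i < r" for i
  proof -
    have "vf l (\<psi> i) f = f * h i - q * h i * (of_nat d * f)"
      unfolding \<psi>_def by (simp add: vf_diff_left vf_scale vf_E h that)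
    also have "\<dots> = f * h i * (1 - q * of_nat d)" by (simp add: algebra_simps)
    finally show ?thesis using q by simp
  qed
  have in_Der0: "vf l (\<psi> i) \<in> Der0 l f" if "i < r" for i
    using that by (simp add: Der0_def \<psi>_f vf_derivation \<psi>_pol)
  have \<psi>_indep: "\<forall>i<r. c i = 0" if c: "\<And>j. j \<le> l \<Longrightarrow> (\<Sum>i<r. c i * \<psi> i j) = 0" for c
  proof -
    have expand: "(\<Sum>i<r. c i * \<psi> i j) = (\<Sum>i<r. c i * \<theta> i j) - q * (\<Sum>i<r. c i * h i) * pvar j" for j
      by (simp add: \<psi>_def right_diff_distrib sum_subtractf sum_distrib_left sum_distrib_right mult_ac)
    \<comment> \<open>The fields \<open>\<theta> i\<close> have no \<open>x_0\<close>-component, so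
      the coefficient at 0 sees only the Euler corrections.\<close>
    have "q * (\<Sum>i<r. c i * h i) * pvar 0 = 0" using expand[of 0] c[of 0] x0 by simp
    then have "q * (\<Sum>i<r. c i * h i) = 0" by (metis mult_eq_0_iff pvar_neq_0)
    then have "(\<Sum>i<r. c i * \<theta> i j) = 0" if "j \<le> l" for j using expand[of j] c[OF that] by simp
    then show ?thesis by (intro indep) auto
  qed
  have "\<exists>!c. c \<in> {..<r} \<rightarrow>\<^sub>E polys l \<and> (\<forall>g\<in>polys l. \<delta> g = (\<Sum>i<r. c i * vf l (\<psi> i) g))"
    if \<delta>: "\<delta> \<in> Der0 l f" for \<delta>
  proof -
    have der: "\<delta> \<in> derivations l" and \<delta>f: "\<delta> f = 0" using \<delta> by (auto simp: Der0_def)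
    define g where "g j = \<delta> (pvar j)" for j
    have \<delta>_eq: "\<delta> p = vf l g p" if "p \<in> polys l" for p
      using derivation_eq_vf[OF der that] by (simp add: g_def[abs_def])
    have g_pol: "g j \<in> polys l" if "j \<le> l" for j
      using der that by (auto simp: g_def derivations_def polys_pvar)
    have gf: "vf l g f = 0" using \<delta>_eq[of f] f \<delta>f by simp
    then obtain u where u: "g 0 = pvar 0 * u" using dvd_x0[of g] by (auto simp: dvd_def)
    \<comment> \<open>Here \<open>u\<close> is \<open>g 0 / x_0\<close>, so subtracting
      \<open>u\<close> times the Euler field removes the \<open>x_0\<close>-component.\<close>
    define g' where "g' j = g j - u * pvar j" for j
    have g'f: "vf l g' f = - (u * of_nat d) * f"
      unfolding g'_def by (simp add: vf_diff_left vf_scale gf vf_E)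
    obtain c where c: "\<forall>j\<in>{1..l}. g' j = (\<Sum>i<r. c i * \<theta> i j)"
      using span[of g'] g'f u by (auto simp: g'_def mult.commute)
    have c': "g' j = (\<Sum>i<r. c i * \<theta> i j)" if "j \<le> l" for j
      using c that u x0 by (cases "j = 0") (auto simp: g'_def mult.commute)
    have "vf l g' f = (\<Sum>i<r. c i * vf l (\<theta> i) f)"
      unfolding vf_combination[symmetric] by (rule vf_cong) (rule c')
    also have "\<dots> = (\<Sum>i<r. c i * h i) * f"
      by (simp add: h sum_distrib_left mult_ac)
    \<comment> \<open>Evaluating \<open>g'\<close> at \<open>f\<close> in two ways shows that
      replacing each \<open>\<theta> i\<close> by \<open>\<psi> i\<close> adds back exactly the
      multiple \<open>u\<close> of the Euler field.\<close>
    finally have ch: "(\<Sum>i<r. c i * h i) = - (u * of_nat d)"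
      unfolding g'f mult_right_cancel[OF f(3)] by (rule sym)
    have gc: "g j = (\<Sum>i<r. c i * \<psi> i j)" if "j \<le> l" for j
    proof -
      have "(\<Sum>i<r. c i * \<psi> i j) = (\<Sum>i<r. c i * \<theta> i j) - q * (\<Sum>i<r. c i * h i) * pvar j"
        by (simp add: \<psi>_def right_diff_distrib sum_subtractf sum_distrib_left sum_distrib_right mult_ac)
      also have "\<dots> = g' j + q * of_nat d * u * pvar j"
        unfolding ch c'[OF that] by (simp add: mult_ac)
      finally show ?thesis using q by (simp add: g'_def)
    qed
    \<comment> \<open>The coefficients \<open>c i\<close> come from the ambient ring. Their
      projections still represent \<open>g\<close>, as all other data lie in \<open>polys l\<close>;
      outside \<open>{..<r}\<close> the function is undefined, as the extensional function space
      demands.\<close>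
    define C where "C = (\<lambda>i\<in>{..<r}. restr_polys l (c i))"
    have gC: "g j = (\<Sum>i<r. C i * \<psi> i j)" if "j \<le> l" for j
    proof -
      have "g j = restr_polys l (\<Sum>i<r. \<psi> i j * c i)"
        using gc[OF that] restr_polys_eq[OF g_pol[OF that]] by (simp add: mult.commute)
      also have "\<dots> = (\<Sum>i<r. C i * \<psi> i j)"
        unfolding restr_sum using that \<psi>_pol
        by (intro sum.cong) (simp_all add: restr_polys_mult C_def mult.commute[of "restr_polys l _"])
      finally show ?thesis .
    qed
    show ?thesis
    proof (rule ex1I[of _ C])
      have "C \<in> {..<r} \<rightarrow>\<^sub>E polys l" by (auto simp: C_def restr_polys_in)
      moreover have "\<delta> p = (\<Sum>i<r. C i * vf l (\<psi> i) p)" if "p \<in> polys l" for p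
        unfolding \<delta>_eq[OF that] vf_combination[symmetric] by (rule vf_cong) (rule gC)
      ultimately show "C \<in> {..<r} \<rightarrow>\<^sub>E polys l \<and> (\<forall>p\<in>polys l. \<delta> p = (\<Sum>i<r. C i * vf l (\<psi> i) p))"
        by blast
    next
      fix C' assume "C' \<in> {..<r} \<rightarrow>\<^sub>E polys l \<and> (\<forall>p\<in>polys l. \<delta> p = (\<Sum>i<r. C' i * vf l (\<psi> i) p))"
      then have C': "C' \<in> {..<r} \<rightarrow>\<^sub>E polys l" "\<forall>p\<in>polys l. \<delta> p = (\<Sum>i<r. C' i * vf l (\<psi> i) p)"
        by auto
      have "(\<Sum>i<r. (C' i - C i) * \<psi> i j) = 0" if "j \<le> l" for j
      proof -
        have "g j = (\<Sum>i<r. C' i * \<psi> i j)"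
          using C'(2) that by (simp add: vf_pvar g_def polys_pvar)
        then show ?thesis using gC[OF that] by (simp add: left_diff_distrib sum_subtractf)
      qed
      then have "\<forall>i<r. C' i - C i = 0" by (rule \<psi>_indep)
      then show "C' = C"
        using C'(1) by (intro extensionalityI[of _ "{..<r}"]) (simp_all add: C_def PiE_def)
    qed
  qed
  then have "derivation_basis l (Der0 l f) r (\<lambda>i. vf l (\<psi> i))"
    using in_Der0 by (simp add: derivation_basis_def)
  moreover have "homogeneous_derivation l (e i) (vf l (\<psi> i))" if "i < r" for i
    using that \<psi>_hom by (simp add: homogeneous_derivation_def vf_pvar)
  ultimately show ?thesis by blast
qed

subsection \<open>The module of logarithmic vector fields\<close>

locale increasing_weights =
  fixes l :: nat and n :: "nat \<Rightarrow> nat"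
  assumes l_ge_2: "l \<ge> 2"
    and n_pos: "\<And>i. 1 \<le> i \<Longrightarrow> i \<le> l \<Longrightarrow> n i \<ge> 1"
    and n_mono: "\<And>i j. 1 \<le> i \<Longrightarrow> i \<le> j \<Longrightarrow> j \<le> l \<Longrightarrow> n i \<le> n j"
begin

section \<open>The factors \<open>P i j\<close> and their pairwise primality\<close>

definition P :: "nat \<Rightarrow> nat \<Rightarrow> 'a::comm_ring_1 mpoly" where
  "P i j = pvar i ^ n i * pvar 0 ^ (n j - n i) - pvar j ^ n j"

lemma var_free_P: "m \<noteq> 0 \<Longrightarrow> m \<noteq> i \<Longrightarrow> m \<noteq> j \<Longrightarrow> var_free m (P i j)"
  unfolding P_def by (intro var_free_intros) auto

text \<open>Up to sign, \<open>P i j\<close> is monic in \<open>x_j\<close>, which handles every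
  other variable. Modulo \<open>x_j\<close> it reduces to a monomial in \<open>x_i\<close> and
  \<open>x_0\<close>.\<close>

lemma relprime_pvar_P:
  assumes "1 \<le> i" "i < j" "j \<le> l"
  shows "relprime (pvar m) (P i j :: 'a::idom mpoly)"
proof -
  define u :: "'a mpoly" where "u = pvar i ^ n i * pvar 0 ^ (n j - n i)"
  have u: "var_free j u" unfolding u_def using assms by (intro var_free_intros) auto
  have P: "P i j = u - pvar j ^ n j" by (simp add: P_def u_def)
  have nj: "n j > 0" using n_pos[of j] assms by simp
  show ?thesis
  proof (cases "m = j")
    case True
    have "u \<noteq> 0" by (simp add: u_def)
    then have "relprime (pvar j) u"
      by (rule relprime_sym[OF relprime_var_free_pvar[OF u]])
    moreover have "pvar j dvd P i j - u" using nj by (simp add: P dvd_power)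
    ultimately show ?thesis unfolding True by (rule relprime_cong)
  next
    case False
    then show ?thesis unfolding P by (intro relprime_var_free_monic var_free_pvar u nj)
  qed
qed

text \<open>If \<open>P i j\<close> were 0, then \<open>x_0\<close> would be prime to 0 and hence a
  unit.\<close>

lemma P_neq_0:
  assumes "1 \<le> i" "i < j" "j \<le> l"
  shows "(P i j :: 'a::idom mpoly) \<noteq> 0"
proof
  assume "(P i j :: 'a mpoly) = 0"
  then have "relprime (pvar 0) (0 :: 'a mpoly)" using relprime_pvar_P[OF assms, of 0] by metis
  then have "pvar 0 dvd (1 :: 'a mpoly)" by (rule relprimeD) simp
  then show False by (simp add: pvar_not_unit)
qed

lemma relprime_P_pvar:
  assumes "1 \<le> i" "i < j" "j \<le> l"
  shows "relprime (P i j :: 'a::idom mpoly) (pvar m)"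
  by (rule relprime_sym[OF relprime_pvar_P[OF assms]]) simp

text \<open>The homogenization of \<open>(y_i - y_t) - (y_s - y_t) = y_i - y_s\<close>.\<close>

lemma P_diff:
  assumes "1 \<le> i" "i < s" "s < t" "t \<le> l"
  shows "P i t - P s t = pvar 0 ^ (n t - n s) * P i s"
proof -
  have "n t - n i = (n s - n i) + (n t - n s)" using n_mono[of i s] n_mono[of s t] assms by simp
  then show ?thesis unfolding P_def by (simp add: power_add algebra_simps)
qed

text \<open>If the second indices differ, the factor with the larger one is monic, up to sign, in a
  variable absent from the other. If they agree, \<open>P_diff\<close> replaces one factor modulo
  the other by a power of \<open>x_0\<close> times a factor with smaller second index.\<close>

lemma relprime_P_P:
  assumes "1 \<le> i" "i < j" "j \<le> l" "1 \<le> i'" "i' < j'" "j' \<le> l" "(i, j) \<noteq> (i', j')"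
  shows "relprime (P i j :: 'a::idom mpoly) (P i' j')"
proof -
  have less: "relprime (P i j :: 'a mpoly) (P i' j')"
    if "1 \<le> i" "i < j" "j < j'" "1 \<le> i'" "i' < j'" "j' \<le> l" for i j i' j'
    using that n_pos[of j'] unfolding P_def[of i' j']
    by (intro relprime_var_free_monic var_free_P var_free_intros) auto
  have eq: "relprime (P i' j :: 'a mpoly) (P i j)" if "1 \<le> i" "i < i'" "i' < j" "j \<le> l" for i i' j
  proof (rule relprime_cong)
    have "relprime (P i' j :: 'a mpoly) (P i i')"
      using that by (intro relprime_sym[OF less] P_neq_0) auto
    then show "relprime (P i' j :: 'a mpoly) (pvar 0 ^ (n j - n i') * P i i')"
      using that by (intro relprime_mult_right relprime_power_right relprime_P_pvar) auto
    show "P i' j dvd P i j - pvar 0 ^ (n j - n i') * P i i'"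
      using P_diff[of i i' j] that by (simp flip: P_diff)
  qed
  consider "j < j'" | "j' < j" | "j = j'" "i < i'" | "j = j'" "i' < i" using assms by force
  then show ?thesis
  proof cases
    case 1 then show ?thesis using assms by (intro less) auto
  next
    case 2 then show ?thesis using assms by (intro relprime_sym[OF less] P_neq_0) auto
  next
    case 3
    show ?thesis unfolding 3(1) using assms 3 by (intro relprime_sym[OF eq] P_neq_0) auto
  next
    case 4
    show ?thesis unfolding 4(1) using assms 4 by (intro eq) auto
  qed
qed

text \<open>A vector field \<open>\<Sum>\<^sub>i g\<^sub>i \<partial>\<^sub>i\<close> with \<open>g\<^sub>0 = 0\<close> is described by \<open>w\<^sub>i = n\<^sub>i g\<^sub>i\<close>;
  then \<open>T i j w\<close> is its value at \<open>P i j\<close>.\<close>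

definition T :: "nat \<Rightarrow> nat \<Rightarrow> (nat \<Rightarrow> 'a::comm_ring_1 mpoly) \<Rightarrow> 'a mpoly" where
  "T i j w = pvar i ^ (n i - 1) * pvar 0 ^ (n j - n i) * w i - pvar j ^ (n j - 1) * w j"

definition log_field :: "nat \<Rightarrow> (nat \<Rightarrow> 'a::comm_ring_1 mpoly) \<Rightarrow> bool" where
  "log_field k w \<longleftrightarrow> (\<forall>i. 1 \<le> i \<and> i \<le> k \<longrightarrow> pvar i dvd w i) \<and>
     (\<forall>i j. 1 \<le> i \<and> i < j \<and> j \<le> l \<longrightarrow> P i j dvd T i j w)"

lemma log_field_diff:
  assumes "log_field k w" "log_field k v"
  shows "log_field k (\<lambda>i. w i - c * v i)"
proof -
  have "T i j (\<lambda>i. w i - c * v i) = T i j w - c * T i j v" for i j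
    by (simp add: T_def algebra_simps)
  then show ?thesis using assms by (auto simp: log_field_def)
qed

lemma pvar_power_Suc: "1 \<le> i \<Longrightarrow> i \<le> l \<Longrightarrow> pvar i ^ (n i - 1) * pvar i = pvar i ^ n i"
  using n_pos[of i] by (metis Suc_diff_1 less_le_trans less_one power_Suc2)

text \<open>In terms of \<open>y\<^sub>i = x\<^sub>i ^ n\<^sub>i\<close> with \<open>x\<^sub>0 = 1\<close>, the field \<open>theta s\<close> is
  \<open>\<Sum>\<^sub>i y\<^sub>i (\<Prod>\<^bsub>t>s\<^esub> (y\<^sub>i - y\<^sub>t)) \<partial>/\<partial>y\<^sub>i\<close>, and \<open>lam k\<close> is the multiple of
  \<open>\<Sum>\<^sub>i \<partial>/\<partial>y\<^sub>i\<close> that clears the denominators \<open>x\<^sub>i ^ (n\<^sub>i - 1)\<close> and is tangent to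
  \<open>x\<^sub>1 \<cdots> x\<^sub>k = 0\<close>.\<close>

definition theta :: "nat \<Rightarrow> nat \<Rightarrow> 'a::comm_ring_1 mpoly" where
  "theta s i = (if i \<le> s then pvar i * (\<Prod>t\<in>{s+1..l}. P i t) else 0)"

definition lam :: "nat \<Rightarrow> nat \<Rightarrow> 'a::comm_ring_1 mpoly" where
  "lam k i = pvar 0 ^ (n i - n 1) * (\<Prod>j\<in>{1..l} - {i}. pvar j ^ (n j - 1)) * (\<Prod>j\<in>{1..k}. pvar j)"

text \<open>If \<open>i \<le> s < j\<close>, then \<open>P i j\<close> is a factor of the product in
  \<open>theta s i\<close>. If \<open>j \<le> s\<close>, the products for \<open>i\<close> and
  \<open>j\<close> agree modulo \<open>P i j\<close> by \<open>P_diff\<close>, and so do the powers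
  in front of them.\<close>

lemma theta_log:
  assumes "1 \<le> s" "s \<le> l"
  shows "log_field k (theta s :: nat \<Rightarrow> 'a::comm_ring_1 mpoly)"
  unfolding log_field_def
proof (intro conjI allI impI)
  fix i j assume ij: "1 \<le> i \<and> i < j \<and> j \<le> l"
  consider "s < i" | "i \<le> s" "s < j" | "j \<le> s" by linarith
  then show "P i j dvd T i j (theta s :: nat \<Rightarrow> 'a mpoly)"
  proof cases
    case 1 then show ?thesis using ij by (simp add: T_def theta_def)
  next
    case 2
    then have "P i j dvd (\<Prod>t\<in>{s+1..l}. P i t :: 'a mpoly)" using ij by (intro dvd_prodI) auto
    then show ?thesis using 2 by (auto simp: T_def theta_def intro!: dvd_mult)
  next
    case 3
    define A :: "nat \<Rightarrow> 'a mpoly" where "A i = (\<Prod>t\<in>{s+1..l}. P i t)" for i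
    have "T i j (theta s :: nat \<Rightarrow> 'a mpoly) = (pvar i ^ (n i - 1) * pvar i) * pvar 0 ^ (n j - n i) * A i
        - (pvar j ^ (n j - 1) * pvar j) * A j"
      using 3 ij by (simp add: T_def theta_def A_def mult_ac)
    also have "\<dots> = P i j * A i + pvar j ^ n j * (A i - A j)"
      using ij by (subst (1 2) pvar_power_Suc) (auto simp: P_def algebra_simps)
    finally have *: "T i j (theta s :: nat \<Rightarrow> 'a mpoly) = P i j * A i + pvar j ^ n j * (A i - A j)" .
    have "P i j dvd A i - A j"
      unfolding A_def
    proof (rule dvd_prod_diff)
      fix t assume "t \<in> {s+1..l}"
      then show "P i j dvd (P i t - P j t :: 'a mpoly)" using ij 3 by (subst P_diff) auto
    qed
    then show ?thesis unfolding * by simp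
  qed
qed (simp add: theta_def)

lemma pvar_power_lam:
  assumes "1 \<le> i" "i \<le> l"
  shows "(pvar i ^ (n i - 1) * lam k i :: 'a::comm_ring_1 mpoly) =
    pvar 0 ^ (n i - n 1) * ((\<Prod>j\<in>{1..l}. pvar j ^ (n j - 1)) * (\<Prod>j\<in>{1..k}. pvar j))"
proof -
  have "(\<Prod>j\<in>{1..l}. pvar j ^ (n j - 1) :: 'a mpoly) = pvar i ^ (n i - 1) * (\<Prod>j\<in>{1..l} - {i}. pvar j ^ (n j - 1))"
    using assms by (intro prod.remove) auto
  then show ?thesis by (simp only: lam_def mult_ac)
qed

text \<open>The sum of all \<open>\<partial>/\<partial>y_i\<close> kills every difference
  \<open>y_i - y_j\<close>; accordingly \<open>T i j (lam k)\<close> vanishes identically.\<close>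

lemma lam_log: "log_field k (lam k :: nat \<Rightarrow> 'a::comm_ring_1 mpoly)"
  unfolding log_field_def
proof (intro conjI allI impI)
  fix i assume "1 \<le> i \<and> i \<le> k"
  then have "pvar i dvd (\<Prod>j\<in>{1..k}. pvar j)" by (intro dvd_prodI) auto
  then show "pvar i dvd (lam k i :: 'a mpoly)" unfolding lam_def by (rule dvd_mult)
next
  fix i j assume ij: "1 \<le> i \<and> i < j \<and> j \<le> l"
  define M :: "'a mpoly" where "M = (\<Prod>j\<in>{1..l}. pvar j ^ (n j - 1)) * (\<Prod>j\<in>{1..k}. pvar j)"
  have "(n j - n i) + (n i - n 1) = n j - n 1" using n_mono[of i j] n_mono[of 1 i] ij by simp
  then have e: "(pvar 0 ^ (n j - n i) * pvar 0 ^ (n i - n 1) :: 'a mpoly) = pvar 0 ^ (n j - n 1)"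
    by (metis power_add)
  have lam: "pvar i ^ (n i - 1) * lam k i = pvar 0 ^ (n i - n 1) * M" if "1 \<le> i" "i \<le> l" for i
    unfolding M_def using that by (rule pvar_power_lam)
  have "T i j (lam k :: nat \<Rightarrow> 'a mpoly) = pvar 0 ^ (n j - n i) * (pvar i ^ (n i - 1) * lam k i) - pvar j ^ (n j - 1) * lam k j"
    by (simp add: T_def mult_ac)
  also have "\<dots> = 0" using ij lam[of i] lam[of j] by (simp add: e del: One_nat_def flip: mult.assoc)
  finally show "P i j dvd T i j (lam k :: nat \<Rightarrow> 'a mpoly)" by simp
qed

section \<open>Triangular elimination for \<open>k = l\<close>\<close>

lemma theta_diag_dvd:
  fixes w :: "nat \<Rightarrow> 'a::idom mpoly"
  assumes "log_field l w" "1 \<le> r" "r \<le> l" "\<And>i. r < i \<Longrightarrow> i \<le> l \<Longrightarrow> w i = 0"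
  shows "theta r r dvd w r"
proof -
  \<comment> \<open>As \<open>w t = 0\<close>, the expression \<open>T r t w\<close> is a monomial
    times \<open>w r\<close>, and \<open>P r t\<close> is prime to that monomial.\<close>
  have "P r t dvd w r" if t: "t \<in> {r+1..l}" for t
  proof (rule relprimeD)
    show "relprime (P r t :: 'a mpoly) (pvar r ^ (n r - 1) * pvar 0 ^ (n t - n r))"
      using t assms by (intro relprime_mult_right relprime_power_right relprime_P_pvar) auto
    have "P r t dvd T r t w" using assms t by (auto simp: log_field_def)
    then show "P r t dvd pvar r ^ (n r - 1) * pvar 0 ^ (n t - n r) * w r"
      using assms(4)[of t] t by (simp add: T_def)
  qed
  then have "(\<Prod>t\<in>{r+1..l}. P r t) dvd w r"
    using assms by (intro prod_dvd_relprime relprime_P_P) auto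
  moreover have "pvar r dvd w r" using assms by (auto simp: log_field_def)
  moreover have "relprime (pvar r :: 'a mpoly) (\<Prod>t\<in>{r+1..l}. P r t)"
    using assms by (intro relprime_prod_right relprime_pvar_P) auto
  ultimately show ?thesis by (simp add: theta_def relprime_mult_dvd)
qed

text \<open>The top coefficient is a multiple of the diagonal entry of the matching
  \<open>theta\<close>; subtracting that multiple lowers the largest index at which \<open>w\<close>
  can be nonzero.\<close>

lemma theta_span:
  fixes w :: "nat \<Rightarrow> 'a::idom mpoly"
  assumes "r \<le> l" "log_field l w" "\<And>i. r < i \<Longrightarrow> i \<le> l \<Longrightarrow> w i = 0"
  shows "\<exists>b. \<forall>i\<in>{1..l}. w i = (\<Sum>s\<in>{1..r}. b s * theta s i)"
  using assms
proof (induction r arbitrary: w)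
  case (Suc r)
  obtain c where c: "w (Suc r) = theta (Suc r) (Suc r) * c"
    using theta_diag_dvd[of w "Suc r"] Suc.prems by (auto elim!: dvdE)
  define v where "v = (\<lambda>i. w i - c * theta (Suc r) i)"
  have "log_field l v"
    unfolding v_def using Suc.prems by (intro log_field_diff theta_log) auto
  moreover have "v i = 0" if "r < i" "i \<le> l" for i
  proof (cases "i = Suc r")
    case False
    then show ?thesis using that Suc.prems(3)[of i] by (simp add: v_def theta_def)
  qed (simp add: v_def c mult.commute)
  ultimately obtain b where b: "\<forall>i\<in>{1..l}. v i = (\<Sum>s\<in>{1..r}. b s * theta s i)"
    using Suc.IH[of v] Suc.prems(1) by auto
  have "w i = (\<Sum>s\<in>{1..Suc r}. (b(Suc r := c)) s * theta s i)" if "i \<in> {1..l}" for i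
  proof -
    have "w i = v i + c * theta (Suc r) i" by (simp add: v_def)
    then show ?thesis using b that by simp
  qed
  then show ?case by blast
qed simp

text \<open>The matrix is triangular with nonzero diagonal, so the coefficients vanish one after
  another, from \<open>s = l\<close> downwards.\<close>

lemma theta_indep:
  fixes b :: "nat \<Rightarrow> 'a::idom mpoly"
  assumes "\<And>i. i \<in> {1..l} \<Longrightarrow> (\<Sum>s\<in>{1..l}. b s * theta s i) = 0" "s \<in> {1..l}"
  shows "b s = 0"
  using assms(2)
proof (induction "l - s" arbitrary: s rule: less_induct)
  case less
  have "b r * theta r s = 0" if "r \<in> {1..l} - {s}" for r
  proof (cases "r < s")
    case False
    then have "b r = 0" using that less.prems by (intro less.hyps) auto
    then show ?thesis by simp
  qed (simp add: theta_def)
  then have "(\<Sum>r\<in>{1..l} - {s}. b r * theta r s) = 0"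
    by (intro sum.neutral) blast
  then have "(\<Sum>r\<in>{1..l}. b r * theta r s) = b s * theta s s"
    using less.prems by (subst sum.remove[of _ s]) simp_all
  moreover have "(theta s s :: 'a mpoly) \<noteq> 0"
    using less.prems P_neq_0[where 'a='a] by (auto simp: theta_def)
  ultimately show ?case using assms(1)[OF less.prems] by simp
qed

text \<open>Newton interpolation at the nodes \<open>y\<^sub>m, y\<^bsub>m-1\<^esub>, \<dots>\<close> of the function sending \<open>y\<^sub>i\<close> to the
  product of the other nodes.\<close>

lemma newton_identity:
  assumes "1 \<le> i" "i \<le> m" "m \<le> l"
  shows "(\<Prod>j\<in>{i+1..m}. pvar j ^ n j :: 'a::comm_ring_1 mpoly) = (\<Sum>s\<in>{i..m}. (-1) ^ (m - s) *
     ((\<Prod>j\<in>{i..<s}. pvar j ^ n j) * pvar 0 ^ (n s - n i) * (\<Prod>t\<in>{s+1..m}. P i t)))"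
    (is "_ = (\<Sum>s\<in>_. ?f m s)")
  using assms(2,3)
proof (induction m rule: dec_induct)
  case (step m)
  have "(\<Sum>s\<in>{i..Suc m}. ?f (Suc m) s) = (\<Sum>s\<in>{i..m}. ?f (Suc m) s) + ?f (Suc m) (Suc m)"
    using step by simp
  \<comment> \<open>A new node contributes one more sign and one more Newton factor to every old
    summand.\<close>
  also have "(\<Sum>s\<in>{i..m}. ?f (Suc m) s) = (\<Sum>s\<in>{i..m}. - P i (Suc m) * ?f m s)"
  proof (intro sum.cong refl)
    fix s assume "s \<in> {i..m}"
    then have "(-1 :: 'a mpoly) ^ (Suc m - s) = - ((-1) ^ (m - s))"
      and "(\<Prod>t\<in>{s+1..Suc m}. P i t :: 'a mpoly) = P i (Suc m) * (\<Prod>t\<in>{s+1..m}. P i t)"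
      by (simp_all add: Suc_diff_le mult.commute)
    then show "?f (Suc m) s = - P i (Suc m) * ?f m s"
      by (simp only:) (simp add: mult_ac)
  qed
  also have "\<dots> = - P i (Suc m) * (\<Prod>j\<in>{i+1..m}. pvar j ^ n j)"
    unfolding sum_distrib_left[symmetric] using step by simp
  also have "?f (Suc m) (Suc m) = (\<Prod>j\<in>{i..m}. pvar j ^ n j) * pvar 0 ^ (n (Suc m) - n i)"
    by (simp flip: atLeastLessThanSuc_atLeastAtMost)
  also have "(\<Prod>j\<in>{i..m}. pvar j ^ n j) = pvar i ^ n i * (\<Prod>j\<in>{i+1..m}. pvar j ^ n j)"
    using step by (simp add: prod.atLeast_Suc_atMost)
  also have "- P i (Suc m) * (\<Prod>j\<in>{i+1..m}. pvar j ^ n j) +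
      pvar i ^ n i * (\<Prod>j\<in>{i+1..m}. pvar j ^ n j) * pvar 0 ^ (n (Suc m) - n i) =
      (\<Prod>j\<in>{i+1..m}. pvar j ^ n j) * pvar (Suc m) ^ n (Suc m)"
    by (simp add: P_def algebra_simps)
  also have "\<dots> = (\<Prod>j\<in>{i+1..Suc m}. pvar j ^ n j)"
    using step.hyps by simp
  finally show ?case by (rule sym)
qed simp

text \<open>The coefficients of \<open>lam l\<close> in the basis \<open>theta\<close>. The one at
  \<open>s = 1\<close> is plus or minus 1, so \<open>lam l\<close> can take the place of
  \<open>theta 1\<close>.\<close>

definition newton_coeff :: "nat \<Rightarrow> 'a::comm_ring_1 mpoly" where
  "newton_coeff s = (-1) ^ (l - s) * ((\<Prod>j\<in>{1..<s}. pvar j ^ n j) * pvar 0 ^ (n s - n 1))"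

text \<open>This is \<open>newton_identity\<close> for \<open>m = l\<close>, multiplied by
  \<open>x_i\<close>, by the \<open>y_j\<close> with \<open>j < i\<close> and by a power of
  \<open>x_0\<close>. The summands with \<open>s < i\<close> vanish.\<close>

lemma lam_expansion:
  assumes i: "i \<in> {1..l}"
  shows "lam l i = (\<Sum>s\<in>{1..l}. newton_coeff s * theta s i :: 'a::comm_ring_1 mpoly)"
proof -
  have split: "{1..l} - {i} = {1..<i} \<union> {i+1..l}" using i by auto
  have "(\<Prod>j\<in>{1..l}. pvar j :: 'a mpoly) = pvar i * (\<Prod>j\<in>{1..l} - {i}. pvar j)"
    using i by (intro prod.remove) auto
  then have "lam l i = (pvar 0 ^ (n i - n 1) * pvar i :: 'a mpoly) * (\<Prod>j\<in>{1..l} - {i}. pvar j ^ (n j - 1) * pvar j)"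
    by (simp only: lam_def prod.distrib mult_ac)
  also have "(\<Prod>j\<in>{1..l} - {i}. pvar j ^ (n j - 1) * pvar j :: 'a mpoly) = (\<Prod>j\<in>{1..l} - {i}. pvar j ^ n j)"
    by (intro prod.cong pvar_power_Suc) auto
  also have "\<dots> = (\<Prod>j\<in>{1..<i}. pvar j ^ n j) * (\<Prod>j\<in>{i+1..l}. pvar j ^ n j)"
    unfolding split by (intro prod.union_disjoint) auto
  also have "pvar 0 ^ (n i - n 1) * pvar i * \<dots> = (\<Sum>s\<in>{i..l}. newton_coeff s * theta s i)"
  proof -
    have c: "(newton_coeff s * theta s i :: 'a mpoly) = pvar 0 ^ (n i - n 1) * pvar i * (\<Prod>j\<in>{1..<i}. pvar j ^ n j) *
       ((-1) ^ (l - s) * ((\<Prod>j\<in>{i..<s}. pvar j ^ n j) * pvar 0 ^ (n s - n i) * (\<Prod>t\<in>{s+1..l}. P i t)))"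
      if "s \<in> {i..l}" for s
    proof -
      have "(\<Prod>j\<in>{1..<s}. pvar j ^ n j :: 'a mpoly) = (\<Prod>j\<in>{1..<i}. pvar j ^ n j) * (\<Prod>j\<in>{i..<s}. pvar j ^ n j)"
        using that i by (intro prod.atLeastLessThan_concat[symmetric]) auto
      moreover have "n s - n 1 = (n i - n 1) + (n s - n i)"
        using n_mono[of 1 i] n_mono[of i s] that i by simp
      then have "(pvar 0 ^ (n s - n 1) :: 'a mpoly) = pvar 0 ^ (n i - n 1) * pvar 0 ^ (n s - n i)"
        by (simp add: power_add)
      ultimately show ?thesis using that by (simp add: newton_coeff_def theta_def mult_ac)
    qed
    have "(\<Sum>s\<in>{i..l}. newton_coeff s * theta s i) =
        pvar 0 ^ (n i - n 1) * pvar i * (\<Prod>j\<in>{1..<i}. pvar j ^ n j :: 'a mpoly) * (\<Prod>j\<in>{i+1..l}. pvar j ^ n j)"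
      using i by (subst newton_identity) (simp_all add: c sum_distrib_left del: One_nat_def)
    from this[symmetric] show ?thesis by (simp only: mult.assoc)
  qed
  also have "\<dots> = (\<Sum>s\<in>{1..l}. newton_coeff s * theta s i)"
    using i by (intro sum.mono_neutral_left) (auto simp: theta_def)
  finally show ?thesis .
qed

section \<open>Spanning and independence with \<open>lam k\<close> in place of
  \<open>theta 1\<close>\<close>

lemma sum_from_1: "(\<Sum>s\<in>{1..l}. f s) = f 1 + (\<Sum>s\<in>{2..l}. f s :: 'b::comm_monoid_add)"
  using l_ge_2 by (simp add: sum.atLeast_Suc_atMost numeral_2_eq_2)

lemma newton_coeff_1: "newton_coeff 1 = (-1) ^ (l - 1)"
  by (simp add: newton_coeff_def)

lemma lam_Suc: "lam (Suc k) i = lam k i * pvar (Suc k)"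
  by (simp add: lam_def mult.assoc)

text \<open>An exchange argument: the sign \<open>newton_coeff 1\<close> is its own inverse, so
  \<open>theta 1\<close> is expressed through \<open>lam l\<close> and the remaining
  \<open>theta s\<close>.\<close>

lemma lam_span_full:
  fixes w :: "nat \<Rightarrow> 'a::idom mpoly"
  assumes "log_field l w"
  shows "\<exists>b c. \<forall>i\<in>{1..l}. w i = (\<Sum>s\<in>{2..l}. b s * theta s i) + c * lam l i"
proof -
  obtain b where b: "\<forall>i\<in>{1..l}. w i = (\<Sum>s\<in>{1..l}. b s * theta s i)"
    using theta_span[of l w] assms by auto
  define c where "c = b 1 * (-1) ^ (l - 1)"
  have c: "c * (-1) ^ (l - 1) = b 1"
    by (simp add: c_def mult.assoc flip: power_mult_distrib)
  have "w i = (\<Sum>s\<in>{2..l}. (b s - c * newton_coeff s) * theta s i) + c * lam l i" if "i \<in> {1..l}" for i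
  proof -
    have "(\<Sum>s\<in>{2..l}. (b s - c * newton_coeff s) * theta s i) + c * lam l i
        = (\<Sum>s\<in>{2..l}. b s * theta s i) + c * newton_coeff 1 * theta 1 i"
      unfolding lam_expansion[OF that] sum_from_1
      by (simp add: left_diff_distrib sum_subtractf sum_distrib_left algebra_simps)
    also have "\<dots> = w i" using b that c by (simp add: sum_from_1 newton_coeff_1 del: One_nat_def)
    finally show ?thesis by simp
  qed
  then show ?thesis by (intro exI[of _ "\<lambda>s. b s - c * newton_coeff s"] exI[of _ c]) blast
qed

text \<open>The restriction is the residue modulo \<open>x\<^bsub>k+1\<^esub>\<close>, so that subtracting a multiple of \<open>lam k\<close>
  from \<open>w\<close> makes it logarithmic also along \<open>x\<^bsub>k+1\<^esub> = 0\<close>.\<close>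

lemma lam_dvd_restr:
  fixes w :: "nat \<Rightarrow> 'a::idom mpoly"
  assumes w: "log_field k w" and k: "k < l"
  defines "j \<equiv> Suc k"
  shows "lam k j dvd restr (\<lambda>m. lookup m j = 0) (w j)"
proof -
  define Z :: "'a mpoly \<Rightarrow> 'a mpoly" where "Z = restr (\<lambda>m. lookup m j = 0)"
  \<comment> \<open>Taking the residue modulo \<open>x_j\<close> drops \<open>h * pvar j\<close> and
    commutes with a factor free of \<open>x_j\<close>.\<close>
  have Z: "M dvd Z (w j)" if M: "var_free j M" "M dvd w j - h * pvar j" for M h
  proof -
    obtain v where v: "w j - h * pvar j = M * v" using M(2) by (rule dvdE)
    have "Z (h * pvar j) = 0"
      unfolding Z_def using keys_mult[of h "pvar j"]
      by (intro restr_eq_0) (fastforce simp: pvar_def lookup_add)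
    then have "Z (w j) = Z (M * v)" by (simp add: Z_def restr_diff flip: v)
    also have "\<dots> = M * Z v"
      unfolding Z_def using M(1) by (intro restr_mult) (simp add: var_free_def lookup_add)
    finally show ?thesis by simp
  qed
  have j: "1 \<le> j" "j \<le> l" using k by (auto simp: j_def)
  \<comment> \<open>For \<open>i\<close> different from \<open>j\<close>, this is the exponent of
    \<open>x_i\<close> in \<open>lam k j\<close>.\<close>
  define e where "e i = n i - 1 + (if i \<le> k then 1 else 0)" for i
  have below: "pvar i ^ e i * pvar 0 ^ (n j - n i) dvd Z (w j)" if i: "1 \<le> i" "i < j" for i
  proof -
    obtain u where u: "w i = pvar i * u" using w i by (auto simp: log_field_def j_def elim!: dvdE)
    have "P i j dvd T i j w" using w i j by (auto simp: log_field_def)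
    then obtain h where h: "T i j w = P i j * h" by (rule dvdE)
    have ei: "pvar i ^ e i = pvar i ^ (n i - 1) * pvar i" using i by (simp add: e_def j_def)
    have e': "pvar i ^ n i = pvar i ^ (n i - 1) * pvar i"
      using i j by (intro pvar_power_Suc[symmetric]) auto
    have e'': "pvar j ^ n j = pvar j ^ (n j - 1) * pvar j"
      using j by (rule pvar_power_Suc[symmetric])
    \<comment> \<open>The relation \<open>T i j w = P i j * h\<close> is solved for the terms with a
      power of \<open>x_j\<close>; since \<open>x_i\<close> divides \<open>w i\<close>, one more
      factor \<open>x_i\<close> comes out on the right.\<close>
    have "pvar j ^ (n j - 1) * (w j - h * pvar j) = pvar i ^ e i * pvar 0 ^ (n j - n i) * (u - h)"
      using h unfolding T_def P_def u ei e' e'' by (simp add: algebra_simps)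
    then have "pvar i ^ e i * pvar 0 ^ (n j - n i) dvd pvar j ^ (n j - 1) * (w j - h * pvar j)"
      by simp
    moreover have "relprime (pvar i ^ e i * pvar 0 ^ (n j - n i)) (pvar j ^ (n j - 1) :: 'a mpoly)"
      using i by (intro relprime_mult_left relprime_power relprime_pvar_pvar) auto
    ultimately have "pvar i ^ e i * pvar 0 ^ (n j - n i) dvd w j - h * pvar j"
      by (metis relprimeD)
    then show ?thesis using i by (intro Z var_free_intros) auto
  qed
  have above: "pvar i ^ e i dvd Z (w j)" if i: "j < i" "i \<le> l" for i
  proof -
    have "P j i dvd T j i w" using w i j by (auto simp: log_field_def)
    then obtain h where h: "T j i w = P j i * h" by (rule dvdE)
    have ei: "pvar i ^ e i = pvar i ^ (n i - 1)" using i by (simp add: e_def j_def)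
    have e': "pvar i ^ n i = pvar i ^ (n i - 1) * pvar i"
      using i j by (intro pvar_power_Suc[symmetric]) auto
    have e'': "pvar j ^ n j = pvar j ^ (n j - 1) * pvar j"
      using j by (rule pvar_power_Suc[symmetric])
    \<comment> \<open>Now \<open>i > k\<close>, so \<open>w i\<close> need not be divisible by
      \<open>x_i\<close> and only the exponent \<open>n i - 1\<close> is gained.\<close>
    have "pvar j ^ (n j - 1) * pvar 0 ^ (n i - n j) * (w j - h * pvar j) = pvar i ^ e i * (w i - h * pvar i)"
      using h unfolding T_def P_def ei e' e'' by (simp add: algebra_simps)
    then have "pvar i ^ e i dvd pvar j ^ (n j - 1) * pvar 0 ^ (n i - n j) * (w j - h * pvar j)"
      by simp
    moreover have "relprime (pvar i ^ e i) (pvar j ^ (n j - 1) * pvar 0 ^ (n i - n j) :: 'a mpoly)"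
      using i by (intro relprime_mult_right relprime_power relprime_pvar_pvar) auto
    ultimately have "pvar i ^ e i dvd w j - h * pvar j"
      by (metis relprimeD)
    then show ?thesis using i by (intro Z var_free_intros) auto
  qed
  have "pvar 0 ^ (n j - n 1) dvd Z (w j)"
  \<comment> \<open>The index \<open>i = 1\<close> gives the full power of \<open>x_0\<close>; for
    \<open>k = 0\<close> one has \<open>j = 1\<close>, and the exponent is 0.\<close>
  proof (cases "k = 0")
    case False
    then show ?thesis using below[of 1] by (auto simp: j_def intro: dvd_mult_right)
  qed (simp add: j_def)
  moreover have "(\<Prod>i\<in>{1..l} - {j}. pvar i ^ e i) dvd Z (w j)"
  proof (rule prod_dvd_relprime)
    fix i assume "i \<in> {1..l} - {j}"
    then show "pvar i ^ e i dvd Z (w j)"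
      using above[of i] below[of i] by (cases "i < j") (auto intro: dvd_mult_left)
  qed (auto intro!: relprime_power relprime_pvar_pvar)
  moreover have "relprime (pvar 0 ^ (n j - n 1)) (\<Prod>i\<in>{1..l} - {j}. pvar i ^ e i :: 'a mpoly)"
    by (intro relprime_prod_right relprime_power relprime_pvar_pvar) auto
  ultimately have "pvar 0 ^ (n j - n 1) * (\<Prod>i\<in>{1..l} - {j}. pvar i ^ e i) dvd Z (w j)"
    by (intro relprime_mult_dvd)
  also have "(\<Prod>i\<in>{1..l} - {j}. pvar i ^ e i) =
      (\<Prod>i\<in>{1..l} - {j}. pvar i ^ (n i - 1)) * (\<Prod>i\<in>{1..k}. pvar i :: 'a mpoly)"
  proof -
    have "(\<Prod>i\<in>{1..l} - {j}. pvar i ^ e i) =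
      (\<Prod>i\<in>{1..l} - {j}. pvar i ^ (n i - 1)) * (\<Prod>i\<in>{1..l} - {j}. if i \<le> k then pvar i else 1 :: 'a mpoly)"
      unfolding prod.distrib[symmetric] by (intro prod.cong) (auto simp: e_def)
    also have "(\<Prod>i\<in>{1..l} - {j}. if i \<le> k then pvar i else 1 :: 'a mpoly) = (\<Prod>i\<in>{1..k}. pvar i)"
      using k by (intro prod.mono_neutral_cong_right) (auto simp: j_def)
    finally show ?thesis .
  qed
  finally show ?thesis by (simp only: lam_def Z_def mult.assoc)
qed

text \<open>Downward induction on \<open>k\<close> from \<open>l\<close>. After a multiple of
  \<open>lam k\<close> is subtracted, the coefficient at \<open>k + 1\<close> has zero residue
  modulo the variable of that index, and \<open>lam (Suc k)\<close> is itself a multiple of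
  \<open>lam k\<close>.\<close>

lemma lam_span:
  fixes w :: "nat \<Rightarrow> 'a::idom mpoly"
  assumes "k \<le> l" "log_field k w"
  shows "\<exists>b c. \<forall>i\<in>{1..l}. w i = (\<Sum>s\<in>{2..l}. b s * theta s i) + c * lam k i"
  using assms
proof (induction k arbitrary: w rule: inc_induct)
  case base
  then show ?case by (rule lam_span_full)
next
  case (step k)
  obtain c where c: "restr (\<lambda>m. lookup m (Suc k) = 0) (w (Suc k)) = lam k (Suc k) * c"
    using lam_dvd_restr[OF step.prems step.hyps(2)] by (rule dvdE)
  define v where "v = (\<lambda>i. w i - c * lam k i)"
  have "log_field k v"
    unfolding v_def using step.prems by (intro log_field_diff lam_log)
  moreover have "pvar (Suc k) ^ 1 dvd v (Suc k)"
  proof (rule pvar_power_dvd)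
    fix m assume "m \<in> keys (v (Suc k))"
    then show "1 \<le> lookup m (Suc k)"
      unfolding v_def mult.commute[of c] c[symmetric]
      by (auto simp: in_keys_iff lookup_minus lookup_restr split: if_splits)
  qed
  ultimately have "log_field (Suc k) v"
    by (auto simp: log_field_def le_Suc_eq)
  then obtain b c' where b: "\<forall>i\<in>{1..l}. v i = (\<Sum>s\<in>{2..l}. b s * theta s i) + c' * lam (Suc k) i"
    using step.IH by blast
  have "w i = (\<Sum>s\<in>{2..l}. b s * theta s i) + (c' * pvar (Suc k) + c) * lam k i" if "i \<in> {1..l}" for i
    using b that by (simp add: v_def lam_Suc algebra_simps)
  then show ?case by blast
qed

text \<open>Multiplying a relation by \<open>M\<close>, the product of the variables from
  \<open>k + 1\<close> to \<open>l\<close>, turns \<open>lam k\<close> into \<open>lam l\<close>.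
  After expansion in the \<open>theta s\<close>, the coefficient at \<open>s = 1\<close> is
  \<open>c\<close> up to sign.\<close>

lemma lam_indep:
  fixes b :: "nat \<Rightarrow> 'a::idom mpoly"
  assumes "k \<le> l" "\<And>i. i \<in> {1..l} \<Longrightarrow> (\<Sum>s\<in>{2..l}. b s * theta s i) + c * lam k i = 0"
  shows "c = 0 \<and> (\<forall>s\<in>{2..l}. b s = 0)"
proof -
  define M :: "'a mpoly" where "M = (\<Prod>j\<in>{k+1..l}. pvar j)"
  have "{1..l} = {1..k} \<union> {k+1..l}" using assms(1) by auto
  then have "(\<Prod>j\<in>{1..l}. pvar j :: 'a mpoly) = (\<Prod>j\<in>{1..k}. pvar j) * M"
    unfolding M_def by (simp only:) (rule prod.union_disjoint, auto)
  then have lam: "lam l i = lam k i * M" for i by (simp only: lam_def mult.assoc)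
  define d where "d s = (if s = 1 then 0 else M * b s) + c * newton_coeff s" for s
  have "(\<Sum>s\<in>{1..l}. d s * theta s i) = 0" if "i \<in> {1..l}" for i
  proof -
    have "(\<Sum>s\<in>{1..l}. d s * theta s i) = (\<Sum>s\<in>{1..l}. (if s = 1 then 0 else M * b s) * theta s i) + c * lam l i"
      unfolding lam_expansion[OF that] d_def
      by (simp add: distrib_right sum.distrib sum_distrib_left mult.assoc)
    also have "(\<Sum>s\<in>{1..l}. (if s = 1 then 0 else M * b s) * theta s i) = M * (\<Sum>s\<in>{2..l}. b s * theta s i)"
      unfolding sum_from_1 by (simp add: sum_distrib_left mult.assoc cong: sum.cong_simp)
    also have "\<dots> + c * lam l i = M * ((\<Sum>s\<in>{2..l}. b s * theta s i) + c * lam k i)"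
      by (simp add: lam algebra_simps)
    finally show ?thesis using assms(2)[OF that] by simp
  qed
  then have d: "d s = 0" if "s \<in> {1..l}" for s using that by (intro theta_indep[of d])
  from d[of 1] have c: "c = 0" using l_ge_2 by (simp add: d_def newton_coeff_1 del: One_nat_def)
  have "M \<noteq> 0" by (simp add: M_def)
  then have "b s = 0" if "s \<in> {2..l}" for s using d[of s] that c by (simp add: d_def)
  then show ?thesis using c by blast
qed

subsection \<open>The defining polynomial\<close>

definition pairs :: "(nat \<times> nat) set" where
  "pairs = {(i, j). 1 \<le> i \<and> i < j \<and> j \<le> l}"

lemma finite_pairs: "finite pairs"
  by (rule finite_subset[of _ "{..l} \<times> {..l}"]) (auto simp: pairs_def)

lemma x0_Fh_eq:
  "x0_Fh l n k = pvar 0 * (\<Prod>i\<in>{1..k}. pvar i) * (\<Prod>x\<in>pairs. case_prod P x)"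
  unfolding x0_Fh_def pairs_def P_def[abs_def] ..

lemma prod_P_neq_0: "(\<Prod>x\<in>pairs. case_prod P x :: 'a::idom mpoly) \<noteq> 0"
  unfolding prod_zero_iff[OF finite_pairs] using P_neq_0[where 'a='a] by (auto simp: pairs_def)

lemma x0_Fh_neq_0: "(x0_Fh l n k :: 'a::idom mpoly) \<noteq> 0"
  using prod_P_neq_0[where 'a='a] by (simp add: x0_Fh_eq)

lemma polys_P: "i \<le> l \<Longrightarrow> j \<le> l \<Longrightarrow> P i j \<in> polys l"
  unfolding P_def by (intro polys_intros) auto

lemma polys_x0_Fh: "k \<le> l \<Longrightarrow> x0_Fh l n k \<in> polys l"
  unfolding x0_Fh_eq by (intro polys_intros) (auto simp: pairs_def intro: polys_P)

lemma homogeneous_P: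
  assumes "1 \<le> i" "i < j" "j \<le> l"
  shows "homogeneous (n j) (P i j)"
proof -
  have "n j = n i + (n j - n i)" using n_mono[of i j] assms by simp
  then show ?thesis
    unfolding P_def by (metis homogeneous_diff homogeneous_mult homogeneous_pvar_power)
qed

lemma homogeneous_x0_Fh: "\<exists>d > 0. homogeneous d (x0_Fh l n k)"
proof -
  have "homogeneous (1 + (\<Sum>i\<in>{1..k}. 1) + (\<Sum>x\<in>pairs. n (snd x))) (x0_Fh l n k)"
    unfolding x0_Fh_eq
    by (intro homogeneous_mult homogeneous_prod homogeneous_pvar) (auto simp: pairs_def homogeneous_P)
  then show ?thesis by (intro exI conjI) auto
qed

lemma vf_P:
  assumes "g 0 = 0" "1 \<le> i" "i < j" "j \<le> l"
  shows "vf l g (P i j) = T i j (\<lambda>i. of_nat (n i) * g i)"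
proof -
  have "vf l g (pvar 0 ^ (n j - n i)) = 0" using assms(1) by (simp add: vf_power vf_pvar)
  then show ?thesis
    using assms by (simp add: P_def T_def vf_diff vf_mult vf_power vf_pvar mult_ac)
qed

text \<open>Each factor of the polynomial is prime to the product of the others, so tangency to the
  whole divisor gives tangency to each component.\<close>

lemma log_fieldI:
  fixes g :: "nat \<Rightarrow> 'a::idom mpoly"
  assumes k: "k \<le> l" and dvd: "x0_Fh l n k dvd vf l g (x0_Fh l n k)"
  shows "pvar 0 dvd g 0"
    and "g 0 = 0 \<Longrightarrow> log_field k (\<lambda>i. of_nat (n i) * g i)"
proof -
  define M H :: "'a mpoly" where "M = (\<Prod>i\<in>{1..k}. pvar i)" and "H = (\<Prod>x\<in>pairs. case_prod P x)"
  have F: "x0_Fh l n k = pvar 0 * M * H" by (simp add: x0_Fh_eq M_def H_def)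
  have rel_H: "relprime (pvar m) H" for m
    unfolding H_def by (intro relprime_prod_right) (auto simp: pairs_def relprime_pvar_P)
  have rel_M: "relprime (pvar m) (\<Prod>i\<in>A. pvar i :: 'a mpoly)" if "m \<notin> A" for m A
    using that by (intro relprime_prod_right relprime_pvar_pvar) auto
  have "pvar 0 dvd vf l g (pvar 0)"
  proof (rule dvd_vf_factor)
    show "pvar 0 * (M * H) dvd vf l g (pvar 0 * (M * H))"
      using dvd by (simp add: F mult.assoc)
    show "relprime (pvar 0) (M * H)"
      unfolding M_def by (intro relprime_mult_right rel_H rel_M) auto
  qed
  then show "pvar 0 dvd g 0" by (simp add: vf_pvar)
  assume g0: "g 0 = 0"
  show "log_field k (\<lambda>i. of_nat (n i) * g i)"
    unfolding log_field_def
  proof (intro conjI allI impI)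
    fix i assume i: "1 \<le> i \<and> i \<le> k"
    have "M = pvar i * (\<Prod>i\<in>{1..k} - {i}. pvar i)"
      unfolding M_def using i by (intro prod.remove) auto
    then have F': "x0_Fh l n k = pvar i * (pvar 0 * (\<Prod>i\<in>{1..k} - {i}. pvar i) * H)"
      by (simp add: F mult_ac)
    have "pvar i dvd vf l g (pvar i)"
      using dvd unfolding F'
      by (rule dvd_vf_factor) (use i in \<open>auto intro!: relprime_mult_right rel_H rel_M relprime_pvar_pvar\<close>)
    then show "pvar i dvd of_nat (n i) * g i" using i k by (simp add: vf_pvar)
  next
    fix i j assume ij: "1 \<le> i \<and> i < j \<and> j \<le> l"
    define R :: "'a mpoly" where "R = (\<Prod>x\<in>pairs - {(i, j)}. case_prod P x)"
    have "H = P i j * R"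
      unfolding H_def R_def using ij by (subst prod.remove[OF finite_pairs, of "(i, j)"]) (auto simp: pairs_def)
    then have F': "x0_Fh l n k = P i j * (pvar 0 * M * R)" by (simp add: F mult_ac)
    have "P i j dvd vf l g (P i j)"
    proof (rule dvd_vf_factor)
      show "P i j * (pvar 0 * M * R) dvd vf l g (P i j * (pvar 0 * M * R))"
        using dvd by (simp add: F')
      show "relprime (P i j) (pvar 0 * M * R)"
        unfolding M_def R_def using ij
        by (intro relprime_mult_right relprime_prod_right relprime_P_pvar)
           (auto simp: pairs_def intro!: relprime_P_P)
    qed
    then show "P i j dvd T i j (\<lambda>i. of_nat (n i) * g i)" using g0 ij by (simp add: vf_P)
  qed
qed

text \<open>The converse goes from \<open>w\<close> back to \<open>g\<close> by dividing by the
  integers \<open>n i\<close>, which are invertible in characteristic 0.\<close>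

lemma log_fieldD:
  fixes g :: "nat \<Rightarrow> 'a::field_char_0 mpoly"
  assumes "k \<le> l" "g 0 = 0" "log_field k w" "\<And>i. 1 \<le> i \<Longrightarrow> i \<le> l \<Longrightarrow> of_nat (n i) * g i = w i"
  shows "x0_Fh l n k dvd vf l g (x0_Fh l n k)"
  unfolding x0_Fh_eq
proof (intro vf_dvd_mult vf_dvd_prod)
  show "pvar 0 dvd vf l g (pvar 0)" using assms(2) by (simp add: vf_pvar)
next
  fix i assume i: "i \<in> {1..k}"
  have "g i = pconst (1 / of_nat (n i)) * of_nat (n i) * g i"
    using n_pos[of i] i assms(1) by (simp add: pconst_inverse_of_nat)
  also have "\<dots> = pconst (1 / of_nat (n i)) * w i"
    using assms(4)[of i] assms(1) i by (simp add: mult.assoc)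
  finally have "pvar i dvd g i" using assms(3) i by (auto simp: log_field_def)
  then show "pvar i dvd vf l g (pvar i)" using i assms(1) by (simp add: vf_pvar)
next
  fix x assume x: "x \<in> pairs"
  obtain i j where ij: "x = (i, j)" by (cases x)
  then have "T i j (\<lambda>i. of_nat (n i) * g i) = T i j w"
    using x assms(4) by (simp add: T_def pairs_def)
  then show "case_prod P x dvd vf l g (case_prod P x)"
    using x ij assms(2,3) by (simp add: vf_P pairs_def log_field_def)
qed

text \<open>The diagonal derivation with \<open>x\<^sub>i \<mapsto> (i / n\<^sub>i) x\<^sub>i\<close> sends \<open>x\<^sub>i ^ n\<^sub>i\<close> to \<open>i x\<^sub>i ^ n\<^sub>i\<close>; as these
  eigenvalues are distinct, its value at each \<open>P i j\<close> is prime to \<open>P i j\<close>.\<close>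

lemma squarefree_x0_Fh: "squarefree (x0_Fh l n k :: 'a::field_char_0 mpoly)" if k: "k \<le> l"
proof -
  define M H :: "'a mpoly" where "M = pvar 0 * (\<Prod>i\<in>{1..k}. pvar i)" and "H = (\<Prod>x\<in>pairs. case_prod P x)"
  define D :: "'a mpoly \<Rightarrow> 'a mpoly" where "D = vf l (\<lambda>i. pconst (of_nat i / of_nat (n i)) * pvar i)"
  have M: "M = (\<Prod>i\<in>{0..k}. pvar i)"
    by (simp add: M_def prod.atLeast_Suc_atMost)
  have D_pvar: "D (pvar i) = pconst (of_nat i / of_nat (n i)) * pvar i" if "i \<le> l" for i
    using that by (simp add: D_def vf_pvar)
  have D_P: "D (P i j) = of_nat i * P i j - of_nat (j - i) * pvar j ^ n j" if "(i, j) \<in> pairs" for i j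
  proof -
    have pow: "D (pvar i ^ n i) = of_nat i * pvar i ^ n i" if i: "1 \<le> i" "i \<le> l" for i
    proof -
      have "D (pvar i ^ n i) = (pconst (of_nat i / of_nat (n i)) * of_nat (n i)) * (pvar i ^ (n i - 1) * pvar i)"
        unfolding D_def vf_power using D_pvar[OF i(2)] by (simp add: D_def mult_ac)
      also have "pvar i ^ (n i - 1) * pvar i = pvar i ^ n i" using i by (rule pvar_power_Suc)
      also have "pconst (of_nat i / of_nat (n i) :: 'a) * of_nat (n i) = of_nat i"
        using n_pos[OF i] pconst_mult[of "of_nat i / of_nat (n i) :: 'a" "of_nat (n i)"] by simp
      finally show ?thesis .
    qed
    have "D (pvar 0 ^ e) = 0" for e
      unfolding D_def vf_power by (simp add: vf_pvar pconst_def)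
    then have "D (P i j) = of_nat i * (pvar i ^ n i * pvar 0 ^ (n j - n i)) - of_nat j * pvar j ^ n j"
      using that pow[of i] pow[of j] by (simp add: P_def D_def vf_diff vf_mult pairs_def mult_ac)
    \<comment> \<open>This splitting of the eigenvalue \<open>j\<close> separates a multiple of
      \<open>P i j\<close> from a nonzero multiple of a power of \<open>x_j\<close>.\<close>
    moreover have "of_nat j = (of_nat i + of_nat (j - i) :: 'a mpoly)"
      using that by (simp add: pairs_def of_nat_diff)
    ultimately show ?thesis by (simp add: P_def algebra_simps)
  qed
  have rel_MH: "relprime H M"
    unfolding H_def M using P_neq_0[where 'a='a]
    by (intro relprime_prod_left relprime_prod_right) (auto simp: pairs_def relprime_P_pvar)
  have "relprime (P i j) (D H)" if ij: "(i, j) \<in> pairs" for i j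
  proof (rule relprime_cong)
    define R :: "'a mpoly" where "R = (\<Prod>x\<in>pairs - {(i, j)}. case_prod P x)"
    have "H = P i j * R"
      unfolding H_def R_def using ij by (subst prod.remove[OF finite_pairs, of "(i, j)"]) auto
    then have DH: "D H = P i j * D R + R * D (P i j)" by (simp add: D_def vf_mult)
    have ji: "j - i > 0" using ij by (simp add: pairs_def)
    have "of_nat (j - i) dvd (1 :: 'a mpoly)"
      using pconst_inverse_of_nat[OF ji, where 'a='a] by (metis dvd_triv_right)
    then have "- of_nat (j - i) dvd (1 :: 'a mpoly)" by (rule minus_dvd_iff[THEN iffD2])
    then have "relprime (P i j) (- of_nat (j - i) :: 'a mpoly)" by (rule relprime_unit)
    moreover have "relprime (P i j) R"
      unfolding R_def
    proof (rule relprime_prod_right)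
      fix x assume "x \<in> pairs - {(i, j)}"
      then show "relprime (P i j :: 'a mpoly) (case_prod P x)"
        using ij by (cases x) (auto simp: pairs_def intro!: relprime_P_P)
    qed
    moreover have "relprime (P i j) (pvar j ^ n j :: 'a mpoly)"
      using ij by (intro relprime_power_right relprime_P_pvar) (auto simp: pairs_def)
    ultimately show "relprime (P i j) (- of_nat (j - i) * (R * pvar j ^ n j))"
      by (intro relprime_mult_right)
    \<comment> \<open>Modulo \<open>P i j\<close>, only the summand of the Leibniz rule that
      differentiates this factor survives.\<close>
    have "D H - - of_nat (j - i) * (R * pvar j ^ n j) = P i j * (D R + of_nat i * R)"
      unfolding DH D_P[OF ij] by (simp add: algebra_simps)
    then show "P i j dvd D H - - of_nat (j - i) * (R * pvar j ^ n j)" by simp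
  qed
  then have rel_DH: "relprime H (D H)"
    unfolding H_def using P_neq_0[where 'a='a]
    by (intro relprime_prod_left) (auto simp: pairs_def)
  have "squarefree (M * H)"
  proof (rule squarefree_mult_derivation[of D])
    show "D (x * y) = x * D y + y * D x" for x y by (simp add: D_def vf_mult)
    show "squarefree M" unfolding M by (rule squarefree_prod_pvar) simp
    show "M dvd D M"
      unfolding M D_def
    proof (rule vf_dvd_prod)
      fix i assume "i \<in> {0..k}"
      then show "(pvar i :: 'a mpoly) dvd vf l (\<lambda>i. pconst (of_nat i / of_nat (n i)) * pvar i) (pvar i)"
        using k D_pvar[of i] by (simp add: D_def)
    qed
    show "M \<noteq> 0" by (simp add: M)
    show "H \<noteq> 0" unfolding H_def by (rule prod_P_neq_0)
  qed (rule rel_MH rel_DH)+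
  then show ?thesis by (simp add: x0_Fh_eq M_def H_def)
qed

subsection \<open>Degrees\<close>

lemma homogeneous_theta: "1 \<le> s \<Longrightarrow> homogeneous ((\<Sum>t\<in>{s+1..l}. n t) + 1) (theta s i)" if "1 \<le> i"
proof (cases "i \<le> s")
  case True
  have "homogeneous (1 + (\<Sum>t\<in>{s+1..l}. n t)) (pvar i * (\<Prod>t\<in>{s+1..l}. P i t))"
    using that True by (intro homogeneous_mult homogeneous_pvar homogeneous_prod homogeneous_P) auto
  then show ?thesis using True by (simp add: theta_def add.commute)
qed (simp add: theta_def homogeneous_0)

text \<open>The \<open>x_0\<close>-exponent \<open>n i - n 1\<close> makes up for the missing factor
  of degree \<open>n i - 1\<close>, so the degree is the sum of \<open>n j - 1\<close> over
  \<open>j \<ge> 2\<close>, plus \<open>k\<close>, for every \<open>i\<close>.\<close>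

lemma homogeneous_lam:
  assumes "1 \<le> i" "i \<le> l"
  shows "homogeneous ((\<Sum>t\<in>{2..l}. n t) + 1 + k - l) (lam k i)"
proof -
  have "homogeneous ((n i - n 1) + (\<Sum>j\<in>{1..l} - {i}. n j - 1) + (\<Sum>j\<in>{1..k}. 1)) (lam k i)"
    unfolding lam_def
    by (intro homogeneous_mult homogeneous_prod homogeneous_pvar_power homogeneous_pvar)
  moreover have "(n i - n 1) + (\<Sum>j\<in>{1..l} - {i}. n j - 1) + (\<Sum>j\<in>{1..k}. 1) = (\<Sum>t\<in>{2..l}. n t) + 1 + k - l"
  proof -
    have "(\<Sum>j\<in>{1..l}. n j) = (\<Sum>j\<in>{1..l}. (n j - 1) + 1)"
      by (intro sum.cong refl) (simp add: n_pos del: One_nat_def)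
    then have "(\<Sum>j\<in>{1..l}. n j) = (\<Sum>j\<in>{1..l}. n j - 1) + l"
      unfolding sum.distrib by simp
    moreover have "(\<Sum>j\<in>{1..l}. n j - 1) = (n i - 1) + (\<Sum>j\<in>{1..l} - {i}. n j - 1)"
      using assms by (intro sum.remove) auto
    moreover have "n i \<ge> n 1" "n 1 \<ge> 1"
      using n_mono[of 1 i] n_pos[of 1] assms by auto
    ultimately show ?thesis using sum_from_1[of n] by simp
  qed
  ultimately show ?thesis by simp
qed

text \<open>The order \<open>theta l\<close>, ..., \<open>theta 2\<close>, \<open>lam k\<close>
  matches the entries of \<open>exponent_list\<close>.\<close>

definition basis_field :: "nat \<Rightarrow> nat \<Rightarrow> nat \<Rightarrow> 'a::comm_ring_1 mpoly" where
  "basis_field k i = (if i < l - 1 then theta (l - i) else lam k)"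

lemma length_exponent_list: "length (exponent_list l n k) = l"
  using l_ge_2 by (simp add: exponent_list_def del: upt_Suc)

lemma homogeneous_basis_field:
  assumes "i < l" "1 \<le> j" "j \<le> l"
  shows "homogeneous (exponent_list l n k ! i) (basis_field k i j)"
proof -
  consider "i = 0" | "1 \<le> i" "i < l - 1" | "i = l - 1" using assms by linarith
  then show ?thesis
  proof cases
    case 1
    then show ?thesis using homogeneous_theta[of j l] assms l_ge_2
      by (simp add: basis_field_def exponent_list_def)
  next
    case 2
    have "exponent_list l n k ! i = (\<Sum>t\<in>{l - i + 1..l}. n t) + 1"
    proof -
      \<comment> \<open>The degree of \<open>theta (l - i)\<close> sums from the next index
        \<open>l - i + 1\<close>; the shift to \<open>i - 1\<close> accounts for the leading entry
        1.\<close>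
      have "rev [3..<Suc l] ! (i - 1) = l - i + 1"
        using 2 by (subst rev_nth) (auto simp del: upt_Suc)
      then show ?thesis
        using 2 by (simp add: exponent_list_def nth_append nth_Cons' del: upt_Suc)
    qed
    moreover have "1 \<le> l - i" using 2 by linarith
    ultimately show ?thesis using homogeneous_theta[of j "l - i"] assms 2 by (simp add: basis_field_def)
  next
    case 3
    have "exponent_list l n k ! i = (\<Sum>t\<in>{2..l}. n t) + 1 + k - l"
      using 3 l_ge_2 by (simp add: exponent_list_def nth_append del: upt_Suc)
    then show ?thesis using homogeneous_lam[of j k] assms 3 by (simp add: basis_field_def)
  qed
qed

lemma polys_basis_field:
  assumes "i < l" "1 \<le> j" "j \<le> l" "k \<le> l"
  shows "basis_field k i j \<in> polys l"
  unfolding basis_field_def theta_def lam_def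
  using assms by (auto intro!: polys_intros polys_P)

lemma basis_field_log: "i < l \<Longrightarrow> log_field k (basis_field k i)"
  unfolding basis_field_def by (auto intro: theta_log lam_log)

lemma sum_basis_field:
  "(\<Sum>i<l. c i * basis_field k i j) = (\<Sum>s\<in>{2..l}. c (l - s) * theta s j) + c (l - 1) * lam k j"
proof -
  have "{..<l} = insert (l - 1) {..<l - 1}" using l_ge_2 by auto
  then have "(\<Sum>i<l. c i * basis_field k i j) = (\<Sum>i<l - 1. c i * theta (l - i) j) + c (l - 1) * lam k j"
    by (simp add: basis_field_def add.commute)
  also have "(\<Sum>i<l - 1. c i * theta (l - i) j) = (\<Sum>s\<in>{2..l}. c (l - s) * theta s j)"
    by (rule sum.reindex_bij_witness[of _ "\<lambda>s. l - s" "\<lambda>i. l - i"]) auto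
  finally show ?thesis .
qed

lemma free_divisor_x0_Fh:
  assumes k: "k \<le> l"
  shows "free_divisor l (x0_Fh l n k :: 'a::field_char_0 mpoly) (exponent_list l n k)"
proof -
  define f :: "'a mpoly" where "f = x0_Fh l n k"
  define q :: "nat \<Rightarrow> 'a mpoly" where "q j = pconst (1 / of_nat (n j))" for j
  \<comment> \<open>Dividing by \<open>n j\<close> passes from the coefficients \<open>w j\<close>
    of \<open>basis_field\<close> to those of the actual vector field.\<close>
  define \<theta> where "\<theta> i j = (if j = 0 then 0 else q j * basis_field k i j)" for i j
  obtain d where d: "d > 0" "homogeneous d f" using homogeneous_x0_Fh unfolding f_def by blast
  have q: "q j * of_nat (n j) = 1" if "1 \<le> j" "j \<le> l" for j
    unfolding q_def using n_pos[OF that] by (intro pconst_inverse_of_nat) simp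
  have q_cancel: "of_nat (n j) * (q j * a) = a" if "1 \<le> j" "j \<le> l" for j a
  proof -
    have "of_nat (n j) * (q j * a) = (q j * of_nat (n j)) * a" by (simp only: mult_ac)
    then show ?thesis by (simp only: q[OF that] mult_1)
  qed
  have "\<exists>\<psi>. derivation_basis l (Der0 l f) l \<psi> \<and>
      (\<forall>i<l. homogeneous_derivation l (exponent_list l n k ! i) (\<psi> i))"
  proof (rule Der0_basis[of f l d l \<theta>])
    show "f \<in> polys l" "f \<noteq> 0" unfolding f_def by (rule polys_x0_Fh[OF k] x0_Fh_neq_0)+
    show "\<theta> i j \<in> polys l" if "i < l" "j \<le> l" for i j
      using that k by (auto simp: \<theta>_def q_def intro!: polys_intros polys_basis_field)
    show "homogeneous (exponent_list l n k ! i) (\<theta> i j)" if "i < l" "j \<le> l" for i j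
      using homogeneous_mult[OF homogeneous_pconst homogeneous_basis_field[of i j k]] that
      by (cases "j = 0") (simp_all add: \<theta>_def q_def homogeneous_0)
    show "f dvd vf l (\<theta> i) f" if "i < l" for i
      unfolding f_def using k _ basis_field_log[OF that]
      by (rule log_fieldD) (simp_all add: \<theta>_def q_cancel)
    show "pvar 0 dvd g 0" if "f dvd vf l g f" for g
      using k that unfolding f_def by (rule log_fieldI)
    show "\<exists>c. \<forall>j\<in>{1..l}. g j = (\<Sum>i<l. c i * \<theta> i j)" if g: "f dvd vf l g f" "g 0 = 0" for g
    proof -
      have "log_field k (\<lambda>i. of_nat (n i) * g i)"
        using k g unfolding f_def by (rule log_fieldI)
      then obtain b c where bc: "\<forall>j\<in>{1..l}. of_nat (n j) * g j = (\<Sum>s\<in>{2..l}. b s * theta s j) + c * lam k j"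
        using lam_span[OF k] by blast
      define a where "a i = (if i < l - 1 then b (l - i) else c)" for i
      have "g j = (\<Sum>i<l. a i * \<theta> i j)" if j: "j \<in> {1..l}" for j
      proof -
        have "g j = q j * (of_nat (n j) * g j)" using q[of j] j by (simp flip: mult.assoc)
        also have "of_nat (n j) * g j = (\<Sum>i<l. a i * basis_field k i j)"
          using bc j l_ge_2 by (auto simp: sum_basis_field a_def intro!: sum.cong)
        finally show ?thesis using j by (simp add: \<theta>_def sum_distrib_left mult.left_commute)
      qed
      then show ?thesis by blast
    qed
    show "\<forall>i<l. c i = 0" if c: "\<forall>j\<in>{1..l}. (\<Sum>i<l. c i * \<theta> i j) = 0" for c
    proof -
      have "(\<Sum>s\<in>{2..l}. c (l - s) * theta s j) + c (l - 1) * lam k j = 0" if j: "j \<in> {1..l}" for j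
      proof -
        have "(\<Sum>i<l. c i * basis_field k i j) = of_nat (n j) * (\<Sum>i<l. c i * \<theta> i j)"
          using j by (simp add: sum_distrib_left \<theta>_def mult.left_commute[of _ "c _"] q_cancel)
        then show ?thesis using c j by (simp add: sum_basis_field)
      qed
      then have "c (l - 1) = 0 \<and> (\<forall>s\<in>{2..l}. c (l - s) = 0)"
        by (rule lam_indep[OF k])
      then have z: "c (l - 1) = 0" "\<forall>s\<in>{2..l}. c (l - s) = 0" by blast+
      have "c i = 0" if "i < l" for i
        using z(1) bspec[OF z(2), of "l - i"] that by (cases "i = l - 1") auto
      then show ?thesis by blast
    qed
  qed (use d in \<open>simp_all add: \<theta>_def\<close>)
  then show ?thesis
    unfolding free_divisor_def f_def[symmetric]
    using d polys_x0_Fh[OF k, where 'a='a] squarefree_x0_Fh[OF k, where 'a='a] length_exponent_list[of k]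
    by (auto simp: f_def)
qed

end

theorem theorem6p11:
  fixes l k :: nat and n :: "nat \<Rightarrow> nat"
  assumes "l \<ge> 2"
    and "\<And>i. 1 \<le> i \<Longrightarrow> i \<le> l \<Longrightarrow> n i \<ge> 1"
    and "\<And>i j. 1 \<le> i \<Longrightarrow> i \<le> j \<Longrightarrow> j \<le> l \<Longrightarrow> n i \<le> n j"
    and "k \<le> l"
  shows "free_divisor l (x0_Fh l n k :: 'a::field_char_0 mpoly) (exponent_list l n k)"
proof -
  interpret increasing_weights l n by unfold_locales (use assms in auto)
  show ?thesis using assms(4) by (rule free_divisor_x0_Fh)
qed

end
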